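(* Let $(A,\circ)$ be a left-symmetric algebra over a field $\Bbbk$, let $\mathcal D(A)=(T(A),\vdash,\dashv)$, and let $\iota:A\to\mathcal D(A)$, $\iota(a)=a$. Then for every left-symmetric dialgebra $B$ and for every homomorphism of left-symmetric algebras $\tau:A\to B^\circ$ there exists a unique homomorphism of dialgebras $\varphi:\mathcal D(A)\to B$ such that $\varphi\iota=\tau$.
   Context: $\Bbbk$ is an arbitrary field. A left-symmetric algebra is a linear space with a bilinear operation $\circ$ satisfying $(a,b,c)=(b,a,c)$, where $(a,b,c)=(a\circ b)\circ c-a\circ(b\circ c)$. A left-symmetric dialgebra is a linear space with two bilinear operations $\vdash,\dashv$ such that for all $x_1,x_2,x_3$: $(x_1\dashv x_2)\vdash x_3=(x_1\vdash x_2)\vdash x_3$; $\;x_1\dashv(x_2\vdash x_3)=x_1\dashv(x_2\dashv x_3)$; $(x_1\dashv x_2)\dashv x_3-x_1\dashv(x_2\dashv x_3)=(x_2\vdash x_1)\dashv x_3-x_2\vdash(x_1\dashv x_3)$; $(x_1\vdash x_2)\vdash x_3-x_1\vdash(x_2\vdash x_3)=(x_2\vdash x_1)\vdash x_3-x_2\vdash(x_1\vdash x_3)$. For a left-symmetric dialgebra $B$, $B^\circ$ denotes the left-symmetric algebra $(B,\vdash)$. A homomorphism of dialgebras is a linear map preserving both $\vdash$ and $\dashv$. $T(A)=A\oplus A^{\otimes2}\oplus\dots$ is the associative tensor algebra of the space $A$ without identity; juxtaposition denotes its multiplication. The linear map $M:T(A)\to A$ is $M(a_1\dots a_n)=((\dots((a_1\circ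 a_2)\circ a_3)\circ\dots)\circ a_n)$ for $a_i\in A$ (so $M(a)=a$). The bilinear operations on $T(A)$ are defined (with induction on the length of the second factor for $\vdash$) by $u\vdash a=M(u)\circ a$, $u\vdash(wa)=(u\vdash w)a+w(M(u)\circ a)-wM(u)a$, $u\dashv w=uM(w)$ for $u,w\in T(A)$, $a\in A$. With these operations $\mathcal D(A)=(T(A),\vdash,\dashv)$ is a left-symmetric dialgebra. *)

theory Defs
  imports "HOL-Algebra.Module" "HOL-Algebra.AbelCoset"
begin

definition linear_maps :: "('k, 'r) ring_scheme \<Rightarrow> ('k, 'v, 'm) module_scheme
    \<Rightarrow> ('k, 'w, 'n) module_scheme \<Rightarrow> ('v \<Rightarrow> 'w) set" where
  "linear_maps R V W = {h. h \<in> carrier V \<rightarrow> carrier W \<and>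
     (\<forall>x \<in> carrier V. \<forall>y \<in> carrier V. h (x \<oplus>\<^bsub>V\<^esub> y) = h x \<oplus>\<^bsub>W\<^esub> h y) \<and>
     (\<forall>c \<in> carrier R. \<forall>x \<in> carrier V. h (c \<odot>\<^bsub>V\<^esub> x) = c \<odot>\<^bsub>W\<^esub> h x)}"

definition bilinear_op :: "('k, 'r) ring_scheme \<Rightarrow> ('k, 'v, 'm) module_scheme
    \<Rightarrow> ('v \<Rightarrow> 'v \<Rightarrow> 'v) \<Rightarrow> bool" where
  "bilinear_op R V f \<longleftrightarrow>
     (\<forall>x \<in> carrier V. f x \<in> linear_maps R V V \<and> (\<lambda>y. f y x) \<in> linear_maps R V V)"

definition span_module :: "('k, 'r) ring_scheme \<Rightarrow> ('k, 'v, 'm) module_scheme \<Rightarrow> 'v set \<Rightarrow> 'v set"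
  where "span_module R V S = \<Inter>{H. submodule H R V \<and> S \<subseteq> H}"

text \<open>The fields \<open>mult\<close> and \<open>one\<close> of a module record are irrelevant for its module structure.\<close>

definition quotient_module :: "('k, 'v, 'm) module_scheme \<Rightarrow> 'v set \<Rightarrow> ('k, 'v set) module" where
  "quotient_module V N =
     \<lparr>carrier = a_rcosets\<^bsub>V\<^esub> N, mult = undefined, one = undefined,
      zero = N, add = set_add V, smult = (\<lambda>c C. \<Union>x \<in> C. N +>\<^bsub>V\<^esub> (c \<odot>\<^bsub>V\<^esub> x))\<rparr>"


locale left_symmetric_algebra = field R + module R A for R (structure) and A (structure) +
  assumes bilinear: "bilinear_op R A (\<otimes>\<^bsub>A\<^esub>)"
    and left_symmetric: "\<lbrakk>a \<in> carrier A; b \<in> carrier A; c \<in> carrier A\<rbrakk> \<Longrightarrow>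
      (a \<otimes>\<^bsub>A\<^esub> b) \<otimes>\<^bsub>A\<^esub> c \<ominus>\<^bsub>A\<^esub> a \<otimes>\<^bsub>A\<^esub> (b \<otimes>\<^bsub>A\<^esub> c)
        = (b \<otimes>\<^bsub>A\<^esub> a) \<otimes>\<^bsub>A\<^esub> c \<ominus>\<^bsub>A\<^esub> b \<otimes>\<^bsub>A\<^esub> (a \<otimes>\<^bsub>A\<^esub> c)"

definition algebra_hom :: "('k, 'r) ring_scheme \<Rightarrow> ('k, 'v, 'm) module_scheme
    \<Rightarrow> ('k, 'w, 'n) module_scheme \<Rightarrow> ('v \<Rightarrow> 'w) set" where
  "algebra_hom R V W = {h \<in> linear_maps R V W.
     \<forall>x \<in> carrier V. \<forall>y \<in> carrier V. h (x \<otimes>\<^bsub>V\<^esub> y) = h x \<otimes>\<^bsub>W\<^esub> h y}"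

record ('k, 'v) dialgebra = "('k, 'v) module" +
  lop :: "'v \<Rightarrow> 'v \<Rightarrow> 'v"  (infixl \<open>\<turnstile>\<index>\<close> 70)
  rop :: "'v \<Rightarrow> 'v \<Rightarrow> 'v"  (infixl \<open>\<stileturn>\<index>\<close> 70)

locale left_symmetric_dialgebra = field R + module R B for R (structure) and B (structure) +
  assumes bilinear_lop: "bilinear_op R B (\<turnstile>\<^bsub>B\<^esub>)"
    and bilinear_rop: "bilinear_op R B (\<stileturn>\<^bsub>B\<^esub>)"
    and left_bar: "\<lbrakk>x \<in> carrier B; y \<in> carrier B; z \<in> carrier B\<rbrakk> \<Longrightarrow>
      (x \<stileturn>\<^bsub>B\<^esub> y) \<turnstile>\<^bsub>B\<^esub> z = (x \<turnstile>\<^bsub>B\<^esub> y) \<turnstile>\<^bsub>B\<^esub> z"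
    and right_bar: "\<lbrakk>x \<in> carrier B; y \<in> carrier B; z \<in> carrier B\<rbrakk> \<Longrightarrow>
      x \<stileturn>\<^bsub>B\<^esub> (y \<turnstile>\<^bsub>B\<^esub> z) = x \<stileturn>\<^bsub>B\<^esub> (y \<stileturn>\<^bsub>B\<^esub> z)"
    and left_symmetric_rop: "\<lbrakk>x \<in> carrier B; y \<in> carrier B; z \<in> carrier B\<rbrakk> \<Longrightarrow>
      (x \<stileturn>\<^bsub>B\<^esub> y) \<stileturn>\<^bsub>B\<^esub> z \<ominus>\<^bsub>B\<^esub> x \<stileturn>\<^bsub>B\<^esub> (y \<stileturn>\<^bsub>B\<^esub> z)
        = (y \<turnstile>\<^bsub>B\<^esub> x) \<stileturn>\<^bsub>B\<^esub> z \<ominus>\<^bsub>B\<^esub> y \<turnstile>\<^bsub>B\<^esub> (x \<stileturn>\<^bsub>B\<^esub> z)"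
    and left_symmetric_lop: "\<lbrakk>x \<in> carrier B; y \<in> carrier B; z \<in> carrier B\<rbrakk> \<Longrightarrow>
      (x \<turnstile>\<^bsub>B\<^esub> y) \<turnstile>\<^bsub>B\<^esub> z \<ominus>\<^bsub>B\<^esub> x \<turnstile>\<^bsub>B\<^esub> (y \<turnstile>\<^bsub>B\<^esub> z)
        = (y \<turnstile>\<^bsub>B\<^esub> x) \<turnstile>\<^bsub>B\<^esub> z \<ominus>\<^bsub>B\<^esub> y \<turnstile>\<^bsub>B\<^esub> (x \<turnstile>\<^bsub>B\<^esub> z)"

definition left_algebra :: "('k, 'v, 'm) dialgebra_scheme \<Rightarrow> ('k, 'v, 'm) dialgebra_scheme"
  where "left_algebra B = B\<lparr>mult := (\<turnstile>\<^bsub>B\<^esub>)\<rparr>"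

definition dialgebra_hom :: "('k, 'r) ring_scheme \<Rightarrow> ('k, 'v, 'm) dialgebra_scheme
    \<Rightarrow> ('k, 'w, 'n) dialgebra_scheme \<Rightarrow> ('v \<Rightarrow> 'w) set" where
  "dialgebra_hom R D B = {h \<in> linear_maps R D B.
     \<forall>x \<in> carrier D. \<forall>y \<in> carrier D.
       h (x \<turnstile>\<^bsub>D\<^esub> y) = h x \<turnstile>\<^bsub>B\<^esub> h y \<and> h (x \<stileturn>\<^bsub>D\<^esub> y) = h x \<stileturn>\<^bsub>B\<^esub> h y}"


definition words :: "('k, 'a, 'm) module_scheme \<Rightarrow> 'a list set" where
  "words A = lists (carrier A) - {[]}"

text \<open>The free \<open>R\<close>-module on the set of nonempty words over \<open>A\<close>.\<close>

definition word_module :: "('k, 'r) ring_scheme \<Rightarrow> ('k, 'a, 'm) module_scheme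
    \<Rightarrow> ('k, 'a list \<Rightarrow> 'k) module" where
  "word_module R A =
     \<lparr>carrier = {f. range f \<subseteq> carrier R \<and> (\<forall>w. w \<notin> words A \<longrightarrow> f w = \<zero>\<^bsub>R\<^esub>) \<and>
                    finite {w. f w \<noteq> \<zero>\<^bsub>R\<^esub>}},
      mult = undefined, one = undefined,
      zero = (\<lambda>w. \<zero>\<^bsub>R\<^esub>), add = (\<lambda>f g w. f w \<oplus>\<^bsub>R\<^esub> g w), smult = (\<lambda>c f w. c \<otimes>\<^bsub>R\<^esub> f w)\<rparr>"

definition single :: "('k, 'r) ring_scheme \<Rightarrow> 'a list \<Rightarrow> 'a list \<Rightarrow> 'k" where
  "single R w = (\<lambda>v. if v = w then \<one>\<^bsub>R\<^esub> else \<zero>\<^bsub>R\<^esub>)"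

definition tensor_relations :: "('k, 'r) ring_scheme \<Rightarrow> ('k, 'a, 'm) module_scheme
    \<Rightarrow> ('a list \<Rightarrow> 'k) set" where
  "tensor_relations R A = (let F = word_module R A in
     {single R (x @ [a \<oplus>\<^bsub>A\<^esub> b] @ y) \<ominus>\<^bsub>F\<^esub> (single R (x @ [a] @ y) \<oplus>\<^bsub>F\<^esub> single R (x @ [b] @ y)) | x y a b.
        x \<in> lists (carrier A) \<and> y \<in> lists (carrier A) \<and> a \<in> carrier A \<and> b \<in> carrier A} \<union>
     {single R (x @ [c \<odot>\<^bsub>A\<^esub> a] @ y) \<ominus>\<^bsub>F\<^esub> c \<odot>\<^bsub>F\<^esub> single R (x @ [a] @ y) | x y c a.
        x \<in> lists (carrier A) \<and> y \<in> lists (carrier A) \<and> c \<in> carrier R \<and> a \<in> carrier A})"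

definition tensor_kernel :: "('k, 'r) ring_scheme \<Rightarrow> ('k, 'a, 'm) module_scheme
    \<Rightarrow> ('a list \<Rightarrow> 'k) set" where
  "tensor_kernel R A = span_module R (word_module R A) (tensor_relations R A)"

definition tensor_module :: "('k, 'r) ring_scheme \<Rightarrow> ('k, 'a, 'm) module_scheme
    \<Rightarrow> ('k, ('a list \<Rightarrow> 'k) set) module" where
  "tensor_module R A = quotient_module (word_module R A) (tensor_kernel R A)"

text \<open>The monomial \<open>a\<^sub>1\<dots>a\<^sub>n\<close> as an element of the tensor module.\<close>

definition tensor_word :: "('k, 'r) ring_scheme \<Rightarrow> ('k, 'a, 'm) module_scheme
    \<Rightarrow> 'a list \<Rightarrow> ('a list \<Rightarrow> 'k) set" where
  "tensor_word R A w = tensor_kernel R A +>\<^bsub>word_module R A\<^esub> single R w"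

text \<open>\<open>tensor_lift R V g\<close> is the linear map from the tensor module to \<open>V\<close> whose value on each
  monomial \<open>tensor_word R A w\<close> is \<open>g w\<close>. It is meaningful if \<open>g\<close> is multilinear in the letters of
  the word: then the linear extension of \<open>g\<close> is constant on every coset.\<close>

definition linear_extension :: "('k, 'r) ring_scheme \<Rightarrow> ('k, 'v, 'm) module_scheme
    \<Rightarrow> ('a list \<Rightarrow> 'v) \<Rightarrow> ('a list \<Rightarrow> 'k) \<Rightarrow> 'v" where
  "linear_extension R V g f = (\<Oplus>\<^bsub>V\<^esub>w \<in> {w. f w \<noteq> \<zero>\<^bsub>R\<^esub>}. f w \<odot>\<^bsub>V\<^esub> g w)"

definition tensor_lift :: "('k, 'r) ring_scheme \<Rightarrow> ('k, 'v, 'm) module_scheme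
    \<Rightarrow> ('a list \<Rightarrow> 'v) \<Rightarrow> ('a list \<Rightarrow> 'k) set \<Rightarrow> 'v" where
  "tensor_lift R V g u = the_elem (linear_extension R V g ` u)"

text \<open>Multiplication is the bilinear extension of concatenation of words.\<close>

definition tensor_algebra :: "('k, 'r) ring_scheme \<Rightarrow> ('k, 'a, 'm) module_scheme
    \<Rightarrow> ('k, ('a list \<Rightarrow> 'k) set) module" where
  "tensor_algebra R A = (tensor_module R A)
     \<lparr>mult := (\<lambda>u v. tensor_lift R (tensor_module R A)
        (\<lambda>x. tensor_lift R (tensor_module R A) (\<lambda>y. tensor_word R A (x @ y)) v) u)\<rparr>"

definition tensor_incl :: "('k, 'r) ring_scheme \<Rightarrow> ('k, 'a, 'm) module_scheme
    \<Rightarrow> 'a \<Rightarrow> ('a list \<Rightarrow> 'k) set" where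
  "tensor_incl R A a = tensor_word R A [a]"


text \<open>\<open>M (a\<^sub>1\<dots>a\<^sub>n) = ((a\<^sub>1 \<circ> a\<^sub>2) \<circ> \<dots>) \<circ> a\<^sub>n\<close>\<close>

definition tensor_M :: "('k, 'r) ring_scheme \<Rightarrow> ('k, 'a, 'm) module_scheme
    \<Rightarrow> ('a list \<Rightarrow> 'k) set \<Rightarrow> 'a" where
  "tensor_M R A = tensor_lift R A (\<lambda>w. foldl (\<otimes>\<^bsub>A\<^esub>) (hd w) (tl w))"

text \<open>\<open>lop_word R A m w\<close> is \<open>u \<turnstile> w\<close> for any \<open>u\<close> with \<open>M u = m\<close>: the recursion depends on \<open>u\<close>
  only through \<open>M u\<close>.\<close>

fun lop_word :: "('k, 'r) ring_scheme \<Rightarrow> ('k, 'a, 'm) module_scheme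
    \<Rightarrow> 'a \<Rightarrow> 'a list \<Rightarrow> ('a list \<Rightarrow> 'k) set" where
  "lop_word R A m w =
     (if length w \<le> 1 then tensor_incl R A (m \<otimes>\<^bsub>A\<^esub> last w)
      else (let T = tensor_algebra R A; a = last w; w' = butlast w in
        (lop_word R A m w' \<otimes>\<^bsub>T\<^esub> tensor_incl R A a
          \<oplus>\<^bsub>T\<^esub> tensor_word R A w' \<otimes>\<^bsub>T\<^esub> tensor_incl R A (m \<otimes>\<^bsub>A\<^esub> a))
          \<ominus>\<^bsub>T\<^esub> (tensor_word R A w' \<otimes>\<^bsub>T\<^esub> tensor_incl R A m) \<otimes>\<^bsub>T\<^esub> tensor_incl R A a))"

declare lop_word.simps [simp del]

definition tensor_dialgebra :: "('k, 'r) ring_scheme \<Rightarrow> ('k, 'a, 'm) module_scheme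
    \<Rightarrow> ('k, ('a list \<Rightarrow> 'k) set) dialgebra" where
  "tensor_dialgebra R A = (let T = tensor_algebra R A in
     module.extend T (dialgebra.fields
       (\<lambda>u v. tensor_lift R T (lop_word R A (tensor_M R A u)) v)
       (\<lambda>u v. u \<otimes>\<^bsub>T\<^esub> tensor_incl R A (tensor_M R A v))))"

end

theory Submission
  imports Defs
begin

text \<open>In the tensor dialgebra \<open>w a = w \<stileturn> a\<close> for a letter \<open>a\<close>, so a homomorphism \<open>\<phi>\<close> extending \<open>\<tau>\<close> must
  send \<open>a\<^sub>1\<dots>a\<^sub>n\<close> to \<open>(\<dots>(\<tau> a\<^sub>1 \<stileturn> \<tau> a\<^sub>2) \<stileturn> \<dots>) \<stileturn> \<tau> a\<^sub>n\<close>; this is multilinear and hence defines a linear map. The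
  bar identities show that \<open>\<phi> u\<close> and \<open>\<tau> (M u)\<close> are interchangeable as right factors of \<open>\<stileturn>\<close> and as
  left factors of \<open>\<turnstile>\<close>. This gives \<open>\<phi> (u \<stileturn> w) = \<phi> u \<stileturn> \<tau> (M w) = \<phi> u \<stileturn> \<phi> w\<close>, while
  \<open>\<phi> (u \<turnstile> w) = \<phi> u \<turnstile> \<phi> w\<close> follows by induction on the length of \<open>w\<close>: after applying \<open>\<phi>\<close>, the recursion
  for \<open>u \<turnstile> (w a)\<close> is the left-symmetry identity for \<open>\<stileturn>\<close>.\<close>

section \<open>Linear maps between modules\<close>

lemma linear_mapsI:
  assumes "\<And>x. x \<in> carrier V \<Longrightarrow> h x \<in> carrier W"
    and "\<And>x y. \<lbrakk>x \<in> carrier V; y \<in> carrier V\<rbrakk> \<Longrightarrow> h (x \<oplus>\<^bsub>V\<^esub> y) = h x \<oplus>\<^bsub>W\<^esub> h y"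
    and "\<And>c x. \<lbrakk>c \<in> carrier R; x \<in> carrier V\<rbrakk> \<Longrightarrow> h (c \<odot>\<^bsub>V\<^esub> x) = c \<odot>\<^bsub>W\<^esub> h x"
  shows "h \<in> linear_maps R V W"
  using assms by (auto simp: linear_maps_def)

lemma linear_mapsD:
  assumes "h \<in> linear_maps R V W"
  shows "x \<in> carrier V \<Longrightarrow> h x \<in> carrier W"
    and "\<lbrakk>x \<in> carrier V; y \<in> carrier V\<rbrakk> \<Longrightarrow> h (x \<oplus>\<^bsub>V\<^esub> y) = h x \<oplus>\<^bsub>W\<^esub> h y"
    and "\<lbrakk>c \<in> carrier R; x \<in> carrier V\<rbrakk> \<Longrightarrow> h (c \<odot>\<^bsub>V\<^esub> x) = c \<odot>\<^bsub>W\<^esub> h x"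
  using assms by (auto simp: linear_maps_def)

lemma bilinear_opD:
  assumes "bilinear_op R V f"
  shows "x \<in> carrier V \<Longrightarrow> f x \<in> linear_maps R V V"
    and "x \<in> carrier V \<Longrightarrow> (\<lambda>y. f y x) \<in> linear_maps R V V"
  using assms by (auto simp: bilinear_op_def)

text \<open>Gives access to the preservation of zero and of negatives, which follows from additivity
  and is not listed in \<open>linear_maps\<close>.\<close>

lemma linear_maps_hom:
  assumes "module R V" "module R W" "h \<in> linear_maps R V W"
  shows "abelian_group_hom V W h"
proof -
  interpret V: module R V by fact
  interpret W: module R W by fact
  show ?thesis
    using linear_mapsD[OF assms(3)]
    by (intro abelian_group_homI group_hom.intro group_hom_axioms.intro V.a_group W.a_group
        V.abelian_group_axioms W.abelian_group_axioms) (auto simp: hom_def)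
qed

lemma linear_maps_minus:
  assumes "module R V" "module R W" "h \<in> linear_maps R V W" "x \<in> carrier V" "y \<in> carrier V"
  shows "h (x \<ominus>\<^bsub>V\<^esub> y) = h x \<ominus>\<^bsub>W\<^esub> h y"
proof -
  interpret abelian_group_hom V W h using linear_maps_hom assms(1-3) .
  show ?thesis using assms(4,5) by (simp add: a_minus_def)
qed

subsection \<open>Spans and quotient modules\<close>

lemma (in module) span_module_submodule:
  assumes "S \<subseteq> carrier M"
  shows "submodule (span_module R M S) R M"
proof -
  \<comment> \<open>The whole carrier is one of the submodules being intersected; this keeps the
    intersection inside the carrier.\<close>
  have "submodule (carrier M) R M" by (rule carrier_is_submodule)
  moreover have "\<zero>\<^bsub>M\<^esub> \<in> H" if "submodule H R M" for H
    using submodule.axioms(1)[OF that] subgroup.one_closed by fastforce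
  ultimately show ?thesis
    using assms unfolding span_module_def
    by (intro submoduleI) (auto intro: submoduleE(3-5))
qed

lemma span_module_superset: "S \<subseteq> span_module R V S"
  by (auto simp: span_module_def)

text \<open>The kernel of \<open>h\<close> is a submodule containing \<open>S\<close>, hence one of
  the submodules whose intersection is the span.\<close>

lemma linear_map_zero_on_span:
  assumes V: "module R V" and W: "module R W" and h: "h \<in> linear_maps R V W"
    and S: "S \<subseteq> carrier V" and zero: "\<And>x. x \<in> S \<Longrightarrow> h x = \<zero>\<^bsub>W\<^esub>"
    and x: "x \<in> span_module R V S"
  shows "h x = \<zero>\<^bsub>W\<^esub>"
proof -
  interpret V: module R V by fact
  interpret W: module R W by fact
  interpret abelian_group_hom V W h using linear_maps_hom V W h .
  have "submodule {x \<in> carrier V. h x = \<zero>\<^bsub>W\<^esub>} R V"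
    by (rule V.submoduleI) (auto simp: linear_mapsD[OF h])
  with S zero x show ?thesis by (auto simp: span_module_def)
qed

lemma (in module) submodule_abelian_subgroup:
  assumes "submodule N R M"
  shows "abelian_subgroup N M"
  by (rule abelian_subgroupI3)
    (auto intro!: additive_subgroup.intro submodule.axioms(1)[OF assms] abelian_group_axioms)

lemma quotient_module_simps:
  "carrier (quotient_module V N) = a_rcosets\<^bsub>V\<^esub> N"
  "\<zero>\<^bsub>quotient_module V N\<^esub> = N"
  "add (quotient_module V N) = set_add V"
  by (simp_all add: quotient_module_def)

text \<open>The quotient action is encoded as a union over all representatives of a coset. Since
  \<open>N\<close> is closed under scaling, all members of this union are the same coset.\<close>

lemma (in module) coset_smult:
  assumes N: "submodule N R M" and c: "c \<in> carrier R" and x: "x \<in> carrier M"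
  shows "c \<odot>\<^bsub>quotient_module M N\<^esub> (N +>\<^bsub>M\<^esub> x) = N +>\<^bsub>M\<^esub> (c \<odot>\<^bsub>M\<^esub> x)"
proof -
  interpret N: abelian_subgroup N M by (rule submodule_abelian_subgroup[OF N])
  have "N +>\<^bsub>M\<^esub> (c \<odot>\<^bsub>M\<^esub> y) = N +>\<^bsub>M\<^esub> (c \<odot>\<^bsub>M\<^esub> x)" if y: "y \<in> N +>\<^bsub>M\<^esub> x" for y
  proof -
    from y obtain n where n: "n \<in> N" "y = n \<oplus>\<^bsub>M\<^esub> x" by (auto simp: a_r_coset_def')
    have "c \<odot>\<^bsub>M\<^esub> n \<in> N" by (rule submoduleE(4)[OF N c n(1)])
    then have "c \<odot>\<^bsub>M\<^esub> y \<in> N +>\<^bsub>M\<^esub> (c \<odot>\<^bsub>M\<^esub> x)"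
      using n c x by (auto simp: a_r_coset_def' smult_r_distr)
    then show ?thesis using c x N.a_repr_independence' by simp
  qed
  then have "(\<Union>y\<in>N +>\<^bsub>M\<^esub> x. N +>\<^bsub>M\<^esub> (c \<odot>\<^bsub>M\<^esub> y)) = (\<Union>y\<in>N +>\<^bsub>M\<^esub> x. N +>\<^bsub>M\<^esub> (c \<odot>\<^bsub>M\<^esub> x))"
    by (rule SUP_cong[OF refl])
  also have "\<dots> = N +>\<^bsub>M\<^esub> (c \<odot>\<^bsub>M\<^esub> x)" using N.a_rcos_self[OF x] by blast
  finally show ?thesis by (simp add: quotient_module_def)
qed

lemma (in module) quotient_module_module:
  assumes N: "submodule N R M"
  shows "module R (quotient_module M N)"
proof -
  interpret N: abelian_subgroup N M by (rule submodule_abelian_subgroup[OF N])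
  let ?Q = "quotient_module M N"
  \<comment> \<open>Once every element is written as a coset and zero as the coset of zero, each
    module axiom of the quotient becomes the corresponding axiom for representatives.\<close>
  have car: "carrier ?Q = (\<lambda>x. N +>\<^bsub>M\<^esub> x) ` carrier M"
    by (auto simp: quotient_module_simps A_RCOSETS_def')
  have add: "(N +>\<^bsub>M\<^esub> x) \<oplus>\<^bsub>?Q\<^esub> (N +>\<^bsub>M\<^esub> y) = N +>\<^bsub>M\<^esub> (x \<oplus>\<^bsub>M\<^esub> y)"
    if "x \<in> carrier M" "y \<in> carrier M" for x y
    using that by (simp add: quotient_module_simps N.a_rcos_sum)
  have zero: "\<zero>\<^bsub>?Q\<^esub> = N +>\<^bsub>M\<^esub> \<zero>\<^bsub>M\<^esub>"
    by (simp add: quotient_module_simps N.a_subset)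
  have neg: "\<exists>Y\<in>carrier ?Q. Y \<oplus>\<^bsub>?Q\<^esub> X = \<zero>\<^bsub>?Q\<^esub>" if "X \<in> carrier ?Q" for X
  proof -
    from that obtain x where x: "X = N +>\<^bsub>M\<^esub> x" "x \<in> carrier M" by (auto simp only: car)
    then have "(N +>\<^bsub>M\<^esub> \<ominus>\<^bsub>M\<^esub> x) \<oplus>\<^bsub>?Q\<^esub> X = \<zero>\<^bsub>?Q\<^esub>"
      by (simp only: add zero M.a_inv_closed M.l_neg)
    with x show ?thesis unfolding car by blast
  qed
  have group: "abelian_group ?Q"
  proof (rule abelian_groupI)
    show "\<zero>\<^bsub>?Q\<^esub> \<in> carrier ?Q" unfolding car zero by blast
    show "X \<oplus>\<^bsub>?Q\<^esub> Y \<in> carrier ?Q" if "X \<in> carrier ?Q" "Y \<in> carrier ?Q" for X Y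
      using that unfolding car by (auto simp only: add intro!: imageI M.a_closed)
    show "X \<oplus>\<^bsub>?Q\<^esub> Y = Y \<oplus>\<^bsub>?Q\<^esub> X" if "X \<in> carrier ?Q" "Y \<in> carrier ?Q" for X Y
    proof -
      from that obtain x y where "X = N +>\<^bsub>M\<^esub> x" "x \<in> carrier M" "Y = N +>\<^bsub>M\<^esub> y" "y \<in> carrier M"
        by (auto simp only: car)
      then show ?thesis by (simp only: add M.a_comm)
    qed
    show "(X \<oplus>\<^bsub>?Q\<^esub> Y) \<oplus>\<^bsub>?Q\<^esub> Z = X \<oplus>\<^bsub>?Q\<^esub> (Y \<oplus>\<^bsub>?Q\<^esub> Z)"
      if "X \<in> carrier ?Q" "Y \<in> carrier ?Q" "Z \<in> carrier ?Q" for X Y Z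
      using that unfolding car by (auto simp only: add M.a_closed M.a_assoc)
    show "\<zero>\<^bsub>?Q\<^esub> \<oplus>\<^bsub>?Q\<^esub> X = X" if "X \<in> carrier ?Q" for X
      using that unfolding car by (auto simp only: add zero M.l_zero M.zero_closed)
  qed (rule neg)
  note smult = coset_smult[OF N]
  show ?thesis
    by (rule moduleI[OF R.is_cring group]; unfold car)
      (auto simp only: add smult M.a_closed smult_closed R.a_closed R.m_closed smult_l_distr
        smult_r_distr smult_assoc1 smult_one R.one_closed intro!: imageI)
qed

lemma (in module) coset_linear:
  assumes N: "submodule N R M"
  shows "(\<lambda>x. N +>\<^bsub>M\<^esub> x) \<in> linear_maps R M (quotient_module M N)"
proof -
  interpret N: abelian_subgroup N M by (rule submodule_abelian_subgroup[OF N])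
  show ?thesis
    by (rule linear_mapsI)
      (auto simp: quotient_module_simps A_RCOSETS_def' coset_smult[OF N] N.a_rcos_sum)
qed

text \<open>\<open>tensor_lift\<close> reads its value off with \<open>the_elem\<close>, so the
  image of a coset has to be a singleton. It is one because \<open>h\<close> kills \<open>N\<close>,
  and it is not empty because \<open>N\<close> is not.\<close>

lemma (in module) image_coset:
  assumes W: "module R W" and N: "submodule N R M" and h: "h \<in> linear_maps R M W"
    and zero: "\<And>n. n \<in> N \<Longrightarrow> h n = \<zero>\<^bsub>W\<^esub>" and x: "x \<in> carrier M"
  shows "h ` (N +>\<^bsub>M\<^esub> x) = {h x}"
proof -
  interpret W: module R W by fact
  interpret N: abelian_subgroup N M by (rule submodule_abelian_subgroup[OF N])
  have "h (n \<oplus>\<^bsub>M\<^esub> x) = h x" if "n \<in> N" for n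
    using that x by (simp add: linear_mapsD[OF h] zero N.a_Hcarr)
  moreover have "N \<noteq> {}" using submoduleE(2)[OF N] .
  ultimately show ?thesis by (auto simp: a_r_coset_def' image_UN)
qed

subsection \<open>Linear extension from words\<close>

lemma word_module_simps:
  "carrier (word_module R A) = {f. range f \<subseteq> carrier R \<and> (\<forall>w. w \<notin> words A \<longrightarrow> f w = \<zero>\<^bsub>R\<^esub>) \<and>
                    finite {w. f w \<noteq> \<zero>\<^bsub>R\<^esub>}}"
  "\<zero>\<^bsub>word_module R A\<^esub> = (\<lambda>w. \<zero>\<^bsub>R\<^esub>)"
  "f \<oplus>\<^bsub>word_module R A\<^esub> g = (\<lambda>w. f w \<oplus>\<^bsub>R\<^esub> g w)"
  "c \<odot>\<^bsub>word_module R A\<^esub> f = (\<lambda>w. c \<otimes>\<^bsub>R\<^esub> f w)"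
  by (simp_all add: word_module_def)

lemma (in cring) word_module_module:
  fixes A :: "('a, 'c, 'm) module_scheme"
  shows "module R (word_module R A)"
proof -
  have fin_add: "finite {w. f w \<oplus> g w \<noteq> \<zero>}"
    if "finite {w. f w \<noteq> \<zero>}" "finite {w. g w \<noteq> \<zero>}" for f g :: "'c list \<Rightarrow> 'a"
    by (rule finite_subset[OF _ finite_UnI[OF that]]) auto
  have fin_smult: "finite {w. c \<otimes> f w \<noteq> \<zero>}"
    if "finite {w. f w \<noteq> \<zero>}" "c \<in> carrier R" for c and f :: "'c list \<Rightarrow> 'a"
    by (rule finite_subset[OF _ that(1)]) (use that(2) in auto)
  have neg: "\<exists>g\<in>carrier (word_module R A). g \<oplus>\<^bsub>word_module R A\<^esub> f = \<zero>\<^bsub>word_module R A\<^esub>"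
    if "f \<in> carrier (word_module R A)" for f
  proof
    show "(\<lambda>w. \<ominus> f w) \<oplus>\<^bsub>word_module R A\<^esub> f = \<zero>\<^bsub>word_module R A\<^esub>"
      using that by (auto simp: word_module_simps l_neg image_subset_iff)
    have "finite {w. \<ominus> f w \<noteq> \<zero>}"
      by (rule finite_subset[of _ "{w. f w \<noteq> \<zero>}"]) (use that in \<open>auto simp: word_module_simps\<close>)
    then show "(\<lambda>w. \<ominus> f w) \<in> carrier (word_module R A)"
      using that by (auto simp: word_module_simps image_subset_iff)
  qed
  have closed: "f w \<in> carrier R" if "f \<in> carrier (word_module R A)" for f w
    using that by (auto simp: word_module_simps)
  have "abelian_group (word_module R A)"
  proof (rule abelian_groupI)
    fix f g h
    assume f: "f \<in> carrier (word_module R A)" and g: "g \<in> carrier (word_module R A)"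
      and h: "h \<in> carrier (word_module R A)"
    note [simp] = closed[OF f] closed[OF g] closed[OF h]
    show "f \<oplus>\<^bsub>word_module R A\<^esub> g \<in> carrier (word_module R A)"
      using f g by (auto simp: word_module_simps fin_add)
    show "f \<oplus>\<^bsub>word_module R A\<^esub> g = g \<oplus>\<^bsub>word_module R A\<^esub> f"
      by (simp add: word_module_simps(3) a_comm[of "f _"])
    show "(f \<oplus>\<^bsub>word_module R A\<^esub> g) \<oplus>\<^bsub>word_module R A\<^esub> h
        = f \<oplus>\<^bsub>word_module R A\<^esub> (g \<oplus>\<^bsub>word_module R A\<^esub> h)"
      by (simp add: word_module_simps(3) a_assoc)
    show "\<zero>\<^bsub>word_module R A\<^esub> \<oplus>\<^bsub>word_module R A\<^esub> f = f"
      by (simp add: word_module_simps(2,3))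
  qed (simp_all add: neg, simp add: word_module_simps)
  then show ?thesis
  proof (rule moduleI[OF is_cring])
    fix c d f g
    assume c: "c \<in> carrier R" "d \<in> carrier R"
      and f: "f \<in> carrier (word_module R A)" and g: "g \<in> carrier (word_module R A)"
    note [simp] = c closed[OF f] closed[OF g]
    show "c \<odot>\<^bsub>word_module R A\<^esub> f \<in> carrier (word_module R A)"
      using f by (auto simp: word_module_simps fin_smult)
    show "(c \<oplus> d) \<odot>\<^bsub>word_module R A\<^esub> f
        = (c \<odot>\<^bsub>word_module R A\<^esub> f) \<oplus>\<^bsub>word_module R A\<^esub> (d \<odot>\<^bsub>word_module R A\<^esub> f)"
      "c \<odot>\<^bsub>word_module R A\<^esub> (f \<oplus>\<^bsub>word_module R A\<^esub> g)
        = (c \<odot>\<^bsub>word_module R A\<^esub> f) \<oplus>\<^bsub>word_module R A\<^esub> (c \<odot>\<^bsub>word_module R A\<^esub> g)"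
      "(c \<otimes> d) \<odot>\<^bsub>word_module R A\<^esub> f = c \<odot>\<^bsub>word_module R A\<^esub> (d \<odot>\<^bsub>word_module R A\<^esub> f)"
      by (simp_all add: word_module_simps(3,4) m_assoc l_distr r_distr)
  next
    fix f
    assume f: "f \<in> carrier (word_module R A)"
    show "\<one> \<odot>\<^bsub>word_module R A\<^esub> f = f"
      by (simp add: word_module_simps(4) closed[OF f])
  qed
qed

text \<open>The defining sum runs over the support of \<open>f\<close>, which changes when functions
  are added or scaled. Enlarging the index set adds only zero terms, so sums for different functions
  can be compared over one common set.\<close>

lemma (in module) linear_extension_superset:
  assumes "finite S" "{w. f w \<noteq> \<zero>} \<subseteq> S" "range f \<subseteq> carrier R" "g \<in> S \<rightarrow> carrier M"
  shows "linear_extension R M g f = (\<Oplus>\<^bsub>M\<^esub>w \<in> S. f w \<odot>\<^bsub>M\<^esub> g w)"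
  unfolding linear_extension_def
  by (rule M.add.finprod_mono_neutral_cong_left[OF assms(1,2)])
    (use assms(2-4) in \<open>auto simp: image_subset_iff Pi_iff\<close>)

lemma (in module) linear_extension_linear:
  assumes g: "g \<in> words A \<rightarrow> carrier M"
  shows "linear_extension R M g \<in> linear_maps R (word_module R A) M"
proof (rule linear_mapsI)
  let ?F = "word_module R A" and ?E = "linear_extension R M g"
  have sub: "{w. f w \<noteq> \<zero>} \<subseteq> words A" "finite {w. f w \<noteq> \<zero>}" "range f \<subseteq> carrier R"
    if "f \<in> carrier ?F" for f
    using that by (auto simp: word_module_simps)
  have g': "g \<in> {w. f w \<noteq> \<zero>} \<rightarrow> carrier M" if "f \<in> carrier ?F" for f
    using g sub(1)[OF that] by blast
  fix f assume f: "f \<in> carrier ?F"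
  have fc: "f w \<in> carrier R" for w using sub(3)[OF f] by auto
  have eq: "?E h = (\<Oplus>\<^bsub>M\<^esub>w \<in> {w. f w \<noteq> \<zero>}. h w \<odot>\<^bsub>M\<^esub> g w)"
    if "{w. h w \<noteq> \<zero>} \<subseteq> {w. f w \<noteq> \<zero>}" "range h \<subseteq> carrier R" for h
    using sub(2)[OF f] that g'[OF f] by (intro linear_extension_superset) auto
  show "?E f \<in> carrier M"
    unfolding linear_extension_def using fc g'[OF f] by (intro M.finsum_closed) auto
  show "?E (c \<odot>\<^bsub>?F\<^esub> f) = c \<odot>\<^bsub>M\<^esub> ?E f" if c: "c \<in> carrier R" for c
  proof -
    have "?E (c \<odot>\<^bsub>?F\<^esub> f) = (\<Oplus>\<^bsub>M\<^esub>w \<in> {w. f w \<noteq> \<zero>}. (c \<odot>\<^bsub>?F\<^esub> f) w \<odot>\<^bsub>M\<^esub> g w)"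
      using c fc by (intro eq) (auto simp: word_module_simps)
    also have "\<dots> = (\<Oplus>\<^bsub>M\<^esub>w \<in> {w. f w \<noteq> \<zero>}. c \<odot>\<^bsub>M\<^esub> (f w \<odot>\<^bsub>M\<^esub> g w))"
      using c fc g'[OF f] by (intro M.finsum_cong') (auto simp: word_module_simps smult_assoc1 Pi_iff)
    also have "\<dots> = c \<odot>\<^bsub>M\<^esub> ?E f"
      unfolding linear_extension_def using c fc g'[OF f] sub(2)[OF f]
      by (intro finsum_smult_ldistr[symmetric]) auto
    finally show ?thesis .
  qed
  show "?E (f \<oplus>\<^bsub>?F\<^esub> h) = ?E f \<oplus>\<^bsub>M\<^esub> ?E h" if h: "h \<in> carrier ?F" for h
  proof -
    \<comment> \<open>The support of the sum may be smaller than this union because of cancellation;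
      all three sums are taken over the union.\<close>
    let ?S = "{w. f w \<noteq> \<zero>} \<union> {w. h w \<noteq> \<zero>}"
    have hc: "h w \<in> carrier R" for w using sub(3)[OF h] by auto
    have eq: "?E k = (\<Oplus>\<^bsub>M\<^esub>w \<in> ?S. k w \<odot>\<^bsub>M\<^esub> g w)"
      if "{w. k w \<noteq> \<zero>} \<subseteq> ?S" "range k \<subseteq> carrier R" for k
      using sub(2)[OF f] sub(2)[OF h] that g'[OF f] g'[OF h]
      by (intro linear_extension_superset) auto
    have gS: "g \<in> ?S \<rightarrow> carrier M" using g'[OF f] g'[OF h] by auto
    have "?E (f \<oplus>\<^bsub>?F\<^esub> h) = (\<Oplus>\<^bsub>M\<^esub>w \<in> ?S. (f \<oplus>\<^bsub>?F\<^esub> h) w \<odot>\<^bsub>M\<^esub> g w)"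
      using fc hc by (intro eq) (auto simp: word_module_simps)
    also have "\<dots> = (\<Oplus>\<^bsub>M\<^esub>w \<in> ?S. f w \<odot>\<^bsub>M\<^esub> g w \<oplus>\<^bsub>M\<^esub> h w \<odot>\<^bsub>M\<^esub> g w)"
      using fc hc gS by (intro M.finsum_cong') (auto simp: word_module_simps smult_l_distr Pi_iff)
    also have "\<dots> = (\<Oplus>\<^bsub>M\<^esub>w \<in> ?S. f w \<odot>\<^bsub>M\<^esub> g w) \<oplus>\<^bsub>M\<^esub> (\<Oplus>\<^bsub>M\<^esub>w \<in> ?S. h w \<odot>\<^bsub>M\<^esub> g w)"
      using fc hc gS by (intro M.finsum_addf) auto
    also have "\<dots> = ?E f \<oplus>\<^bsub>M\<^esub> ?E h"
      using eq[OF Un_upper1 sub(3)[OF f]] eq[OF Un_upper2 sub(3)[OF h]] by simp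
    finally show ?thesis .
  qed
qed

lemma (in cring) single_closed:
  assumes "w \<in> words A"
  shows "single R w \<in> carrier (word_module R A)"
proof -
  have "finite {v. single R w v \<noteq> \<zero>}"
    by (rule finite_subset[of _ "{w}"]) (auto simp: single_def)
  then show ?thesis using assms by (auto simp: word_module_simps single_def)
qed

lemma (in module) linear_extension_single:
  assumes "g w \<in> carrier M"
  shows "linear_extension R M g (single R w) = g w"
proof -
  have "linear_extension R M g (single R w) = (\<Oplus>\<^bsub>M\<^esub>v \<in> {w}. single R w v \<odot>\<^bsub>M\<^esub> g v)"
    using assms by (intro linear_extension_superset) (auto simp: single_def)
  also have "\<dots> = g w" using assms by (simp add: single_def)
  finally show ?thesis .
qed

text \<open>Induction on the finite support: every element is a finite linear combination of the
  functions \<open>single R w\<close>.\<close>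

lemma (in cring) word_module_induct [consumes 1, case_names single add smult zero]:
  assumes f: "f \<in> carrier (word_module R A)"
    and single: "\<And>w. w \<in> words A \<Longrightarrow> P (single R w)"
    and add: "\<And>f g. \<lbrakk>f \<in> carrier (word_module R A); g \<in> carrier (word_module R A); P f; P g\<rbrakk>
      \<Longrightarrow> P (f \<oplus>\<^bsub>word_module R A\<^esub> g)"
    and smult: "\<And>c f. \<lbrakk>c \<in> carrier R; f \<in> carrier (word_module R A); P f\<rbrakk>
      \<Longrightarrow> P (c \<odot>\<^bsub>word_module R A\<^esub> f)"
    and zero: "P \<zero>\<^bsub>word_module R A\<^esub>"
  shows "P f"
proof -
  let ?F = "word_module R A"
  have "finite {w. f w \<noteq> \<zero>}" using f by (simp add: word_module_simps)
  then show ?thesis using f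
  proof (induction "{w. f w \<noteq> \<zero>}" arbitrary: f rule: finite_induct)
    case empty
    then have "f = \<zero>\<^bsub>?F\<^esub>" by (auto simp: word_module_simps)
    then show ?case using zero by simp
  next
    case (insert w S)
    \<comment> \<open>\<open>?h\<close> is the part of \<open>f\<close> at the word
      \<open>w\<close>, and \<open>?g\<close> is the rest, with support \<open>S\<close>.\<close>
    let ?g = "f(w := \<zero>)" and ?h = "f w \<odot>\<^bsub>?F\<^esub> single R w"
    have S: "S = {v. ?g v \<noteq> \<zero>}" using insert.hyps(2,4) by auto
    have fR: "f v \<in> carrier R" and f0: "v \<notin> words A \<Longrightarrow> f v = \<zero>" for v
      using insert.prems by (auto simp: word_module_simps)
    have fw: "f w \<in> carrier R" by (rule fR)
    have w: "w \<in> words A" using insert.hyps(4) f0 by blast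
    have g: "?g \<in> carrier ?F"
      using insert.hyps(1) fR f0 unfolding S by (auto simp: word_module_simps)
    have h: "?h \<in> carrier ?F"
      by (rule module.smult_closed[OF word_module_module fw single_closed[OF w]])
    have "P ?g" using insert(3)[OF S g] .
    moreover have "P ?h" using smult[OF fw single_closed[OF w] single[OF w]] .
    moreover have "f = ?g \<oplus>\<^bsub>?F\<^esub> ?h"
      using fR by (auto simp: word_module_simps single_def)
    ultimately show ?case using add[OF g h] by simp
  qed
qed

section \<open>Constructions of linear maps\<close>

lemma linear_maps_comp:
  assumes "h \<in> linear_maps R U V" "k \<in> linear_maps R V W"
  shows "(\<lambda>x. k (h x)) \<in> linear_maps R U W"
  by (rule linear_mapsI) (simp_all add: linear_mapsD[OF assms(1)] linear_mapsD[OF assms(2)])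

text \<open>Agreement is assumed on the carrier only, so the closure of \<open>carrier U\<close>
  under the module operations enters.\<close>

lemma linear_maps_cong:
  assumes "module R U" "h \<in> linear_maps R U V" "\<And>x. x \<in> carrier U \<Longrightarrow> k x = h x"
  shows "k \<in> linear_maps R U V"
proof -
  interpret U: module R U by fact
  show ?thesis
    using linear_mapsD[OF assms(2)] assms(3) by (intro linear_mapsI) simp_all
qed

lemma (in module) linear_maps_add:
  assumes h: "h \<in> linear_maps R U M" and k: "k \<in> linear_maps R U M"
  shows "(\<lambda>x. h x \<oplus>\<^bsub>M\<^esub> k x) \<in> linear_maps R U M"
  by (rule linear_mapsI)
    (simp_all add: linear_mapsD[OF h] linear_mapsD[OF k] smult_r_distr M.a_ac)

lemma (in module) linear_maps_smult:
  assumes c: "c \<in> carrier R" and h: "h \<in> linear_maps R U M"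
  shows "(\<lambda>x. c \<odot>\<^bsub>M\<^esub> h x) \<in> linear_maps R U M"
  by (rule linear_mapsI)
    (use c in \<open>simp_all add: linear_mapsD[OF h] smult_r_distr smult_assoc1[symmetric] R.m_comm[of c]\<close>)

lemma (in module) linear_maps_diff:
  assumes h: "h \<in> linear_maps R U M" and k: "k \<in> linear_maps R U M"
  shows "(\<lambda>x. h x \<ominus>\<^bsub>M\<^esub> k x) \<in> linear_maps R U M"
  by (rule linear_mapsI)
    (simp_all add: linear_mapsD[OF h] linear_mapsD[OF k] a_minus_def smult_r_distr
      smult_r_minus M.minus_add M.a_ac)

subsection \<open>Multilinear functions of words\<close>

text \<open>One condition covers the words of every positive length: \<open>x\<close> and
  \<open>y\<close> fix the other letters and the position of the variable one. The value at the
  empty word is unconstrained, in keeping with a tensor algebra without identity.\<close>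

definition word_multilinear :: "('k, 'r) ring_scheme \<Rightarrow> ('k, 'a, 'm) module_scheme
    \<Rightarrow> ('k, 'v, 'n) module_scheme \<Rightarrow> ('a list \<Rightarrow> 'v) \<Rightarrow> bool" where
  "word_multilinear R A V g \<longleftrightarrow>
     (\<forall>x \<in> lists (carrier A). \<forall>y \<in> lists (carrier A). (\<lambda>a. g (x @ a # y)) \<in> linear_maps R A V)"

lemma word_multilinearD:
  assumes "word_multilinear R A V g" "x \<in> lists (carrier A)" "y \<in> lists (carrier A)"
  shows "(\<lambda>a. g (x @ a # y)) \<in> linear_maps R A V"
  using assms by (simp add: word_multilinear_def)

lemma words_ConsI: "\<lbrakk>a \<in> carrier A; x \<in> lists (carrier A)\<rbrakk> \<Longrightarrow> a # x \<in> words A"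
  by (auto simp: words_def)

lemma words_insertI:
  "\<lbrakk>x \<in> lists (carrier A); a \<in> carrier A; y \<in> lists (carrier A)\<rbrakk> \<Longrightarrow> x @ a # y \<in> words A"
  by (auto simp: words_def)

lemma words_lists: "x \<in> words A \<Longrightarrow> x \<in> lists (carrier A)"
  by (auto simp: words_def)

text \<open>Words grow at the right end, as in the recursion for \<turnstile> and in left-normed
  products.\<close>

lemma words_induct [consumes 1, case_names letter snoc]:
  assumes w: "w \<in> words A"
    and letter: "\<And>a. a \<in> carrier A \<Longrightarrow> P [a]"
    and snoc: "\<And>w a. \<lbrakk>w \<in> words A; a \<in> carrier A; P w\<rbrakk> \<Longrightarrow> P (w @ [a])"
  shows "P w"
  using w
proof (induction w rule: rev_induct)
  case Nil
  then show ?case by (simp add: words_def)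
next
  case (snoc a w)
  show ?case
  proof (cases "w = []")
    case True
    then show ?thesis using snoc.prems letter by (simp add: words_def)
  next
    case False
    then have "w \<in> words A" "a \<in> carrier A" using snoc.prems by (auto simp: words_def)
    then show ?thesis using assms(3) snoc.IH by blast
  qed
qed

lemma word_multilinear_closed:
  assumes g: "word_multilinear R A V g" and w: "w \<in> words A"
  shows "g w \<in> carrier V"
proof -
  obtain a y where "w = a # y" "a \<in> carrier A" "y \<in> lists (carrier A)"
    using w by (cases w) (auto simp: words_def)
  then show ?thesis
    using linear_mapsD(1)[OF word_multilinearD[OF g, of "[]" y]] by simp
qed

text \<open>Serves functions given by recursion on the last letter: the variable letter is either
  the last one, or it lies inside the shorter word and its linearity is carried through one step of
  the recursion.\<close>

lemma word_multilinear_snocI: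
  assumes letter: "(\<lambda>a. g [a]) \<in> linear_maps R A V"
    and last: "\<And>w. w \<in> words A \<Longrightarrow> (\<lambda>a. g (w @ [a])) \<in> linear_maps R A V"
    and step: "\<And>x y b. \<lbrakk>x \<in> lists (carrier A); y \<in> lists (carrier A); b \<in> carrier A;
        (\<lambda>a. g (x @ a # y)) \<in> linear_maps R A V\<rbrakk>
      \<Longrightarrow> (\<lambda>a. g ((x @ a # y) @ [b])) \<in> linear_maps R A V"
  shows "word_multilinear R A V g"
  unfolding word_multilinear_def
proof (intro ballI)
  fix x y assume x: "x \<in> lists (carrier A)" and y: "y \<in> lists (carrier A)"
  show "(\<lambda>a. g (x @ a # y)) \<in> linear_maps R A V"
    using y
  proof (induction y rule: rev_induct)
    case Nil
    show ?case using letter last[of x] x by (cases "x = []") (auto simp: words_def)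
  next
    case (snoc b y)
    then show ?case using step[OF x, of y b] by simp
  qed
qed

subsection \<open>The tensor module\<close>

context module
begin

lemma tensor_relations_closed: "tensor_relations R M \<subseteq> carrier (word_module R M)"
proof -
  interpret F: module R "word_module R M" by (rule word_module_module)
  show ?thesis
    by (auto simp: tensor_relations_def Let_def
        intro!: F.M.minus_closed F.M.a_closed F.smult_closed single_closed words_insertI)
qed

lemma tensor_kernel_submodule: "submodule (tensor_kernel R M) R (word_module R M)"
  unfolding tensor_kernel_def
  by (rule module.span_module_submodule[OF word_module_module tensor_relations_closed])

lemma tensor_module_module: "module R (tensor_module R M)"
  unfolding tensor_module_def
  by (rule module.quotient_module_module[OF word_module_module tensor_kernel_submodule])

lemma coset_tensor_linear:
  "(\<lambda>f. tensor_kernel R M +>\<^bsub>word_module R M\<^esub> f)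
    \<in> linear_maps R (word_module R M) (tensor_module R M)"
  unfolding tensor_module_def
  by (rule module.coset_linear[OF word_module_module tensor_kernel_submodule])

lemma tensor_carrierE:
  assumes "u \<in> carrier (tensor_module R M)"
  obtains f where "f \<in> carrier (word_module R M)" "u = tensor_kernel R M +>\<^bsub>word_module R M\<^esub> f"
  using assms by (auto simp: tensor_module_def quotient_module_simps A_RCOSETS_def')

lemma tensor_word_closed: "w \<in> words M \<Longrightarrow> tensor_word R M w \<in> carrier (tensor_module R M)"
  unfolding tensor_word_def by (intro linear_mapsD(1)[OF coset_tensor_linear] single_closed)

text \<open>The projection from the word module is linear and onto, so the induction can be done on
  a representative; the monomials therefore span the tensor module.\<close>

lemma tensor_module_induct [consumes 1, case_names word add smult]:
  assumes u: "u \<in> carrier (tensor_module R M)"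
    and word: "\<And>w. w \<in> words M \<Longrightarrow> P (tensor_word R M w)"
    and add: "\<And>u v. \<lbrakk>u \<in> carrier (tensor_module R M); v \<in> carrier (tensor_module R M); P u; P v\<rbrakk>
      \<Longrightarrow> P (u \<oplus>\<^bsub>tensor_module R M\<^esub> v)"
    and smult: "\<And>c u. \<lbrakk>c \<in> carrier R; u \<in> carrier (tensor_module R M); P u\<rbrakk>
      \<Longrightarrow> P (c \<odot>\<^bsub>tensor_module R M\<^esub> u)"
  shows "P u"
proof -
  note lin = linear_mapsD[OF coset_tensor_linear]
  interpret F: module R "word_module R M" by (rule word_module_module)
  interpret T: module R "tensor_module R M" by (rule tensor_module_module)
  interpret hom: abelian_group_hom "word_module R M" "tensor_module R M"
    "\<lambda>f. tensor_kernel R M +>\<^bsub>word_module R M\<^esub> f"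
    by (rule linear_maps_hom[OF word_module_module tensor_module_module coset_tensor_linear])
  \<comment> \<open>The word consisting of the zero vector always exists. Its multiple by the scalar
    0 yields the zero case from the cases \<open>word\<close> and \<open>smult\<close>.\<close>
  have w: "[\<zero>\<^bsub>M\<^esub>] \<in> words M" by (rule words_ConsI) auto
  have "P (\<zero> \<odot>\<^bsub>tensor_module R M\<^esub> tensor_word R M [\<zero>\<^bsub>M\<^esub>])"
    by (intro smult word tensor_word_closed w R.zero_closed)
  then have zero: "P \<zero>\<^bsub>tensor_module R M\<^esub>"
    by (simp only: T.smult_l_null[OF tensor_word_closed[OF w]])
  from u obtain f where f: "f \<in> carrier (word_module R M)"
    and uf: "u = tensor_kernel R M +>\<^bsub>word_module R M\<^esub> f" by (rule tensor_carrierE)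
  show ?thesis
    unfolding uf using f
  proof (induction f rule: word_module_induct)
    case (single w)
    then show ?case using word by (simp only: tensor_word_def)
  next
    case (add f g)
    then show ?case using assms(3) by (simp only: lin)
  next
    case (smult c f)
    then show ?case using assms(4) by (simp only: lin)
  next
    case zero
    show ?case using \<open>P \<zero>\<^bsub>tensor_module R M\<^esub>\<close> by (simp only: hom.hom_zero)
  qed
qed

lemma tensor_linear_ext:
  assumes h: "h \<in> linear_maps R (tensor_module R M) V"
    and k: "k \<in> linear_maps R (tensor_module R M) V"
    and eq: "\<And>w. w \<in> words M \<Longrightarrow> h (tensor_word R M w) = k (tensor_word R M w)"
    and u: "u \<in> carrier (tensor_module R M)"
  shows "h u = k u"
  using u by (induction u rule: tensor_module_induct)
    (simp_all only: eq linear_mapsD[OF h] linear_mapsD[OF k])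

lemma tensor_word_multilinear: "word_multilinear R M (tensor_module R M) (tensor_word R M)"
  unfolding word_multilinear_def
proof (rule ballI, rule ballI, rule linear_mapsI)
  let ?F = "word_module R M" and ?T = "tensor_module R M"
  let ?q = "\<lambda>f. tensor_kernel R M +>\<^bsub>?F\<^esub> f"
  interpret F: module R ?F by (rule word_module_module)
  interpret T: module R ?T by (rule tensor_module_module)
  note lin = linear_mapsD[OF coset_tensor_linear]
  \<comment> \<open>Elements whose difference is a relation have the same coset. Both linearity
    clauses below thus reduce to exhibiting a generator of the kernel.\<close>
  have eqI: "?q f = ?q g" if f: "f \<in> carrier ?F" and g: "g \<in> carrier ?F"
    and rel: "f \<ominus>\<^bsub>?F\<^esub> g \<in> tensor_relations R M" for f g
  proof -
    interpret N: abelian_subgroup "tensor_kernel R M" ?F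
      by (rule F.submodule_abelian_subgroup[OF tensor_kernel_submodule])
    have "f \<ominus>\<^bsub>?F\<^esub> g \<in> tensor_kernel R M"
      unfolding tensor_kernel_def by (rule subsetD[OF span_module_superset rel])
    then have "f \<in> ?q g" using f g by (simp add: a_minus_def N.a_rcos_module)
    then show ?thesis using g by (rule N.a_repr_independence'[symmetric])
  qed
  fix x y a assume x: "x \<in> lists (carrier M)" and y: "y \<in> lists (carrier M)"
    and a: "a \<in> carrier M"
  have s: "single R (x @ d # y) \<in> carrier ?F" if "d \<in> carrier M" for d
    using x y that by (intro single_closed words_insertI)
  show "tensor_word R M (x @ a # y) \<in> carrier ?T"
    using x y a by (intro tensor_word_closed words_insertI)
  show "tensor_word R M (x @ (c \<odot>\<^bsub>M\<^esub> a) # y) = c \<odot>\<^bsub>?T\<^esub> tensor_word R M (x @ a # y)"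
    if c: "c \<in> carrier R" for c
  proof -
    have "single R (x @ (c \<odot>\<^bsub>M\<^esub> a) # y) \<ominus>\<^bsub>?F\<^esub> c \<odot>\<^bsub>?F\<^esub> single R (x @ a # y) \<in> tensor_relations R M"
      unfolding tensor_relations_def Let_def append_Cons append_Nil using x y a c by blast
    from eqI[OF s[OF smult_closed[OF c a]] F.smult_closed[OF c s[OF a]] this]
    show ?thesis unfolding tensor_word_def by (simp only: lin(3)[OF c s[OF a]])
  qed
  show "tensor_word R M (x @ (a \<oplus>\<^bsub>M\<^esub> b) # y)
      = tensor_word R M (x @ a # y) \<oplus>\<^bsub>?T\<^esub> tensor_word R M (x @ b # y)"
    if b: "b \<in> carrier M" for b
  proof -
    have "single R (x @ (a \<oplus>\<^bsub>M\<^esub> b) # y) \<ominus>\<^bsub>?F\<^esub> (single R (x @ a # y) \<oplus>\<^bsub>?F\<^esub> single R (x @ b # y))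
        \<in> tensor_relations R M"
      unfolding tensor_relations_def Let_def append_Cons append_Nil using x y a b by blast
    from eqI[OF s[OF M.a_closed[OF a b]] F.M.a_closed[OF s[OF a] s[OF b]] this]
    show ?thesis unfolding tensor_word_def by (simp only: lin(2)[OF s[OF a] s[OF b]])
  qed
qed

text \<open>Multilinearity of \<open>g\<close> says precisely that its linear extension vanishes on
  the two families of relations, and vanishing passes from generators to their span.\<close>

lemma linear_extension_kernel:
  assumes V: "module R V" and g: "word_multilinear R M V g" and n: "n \<in> tensor_kernel R M"
  shows "linear_extension R V g n = \<zero>\<^bsub>V\<^esub>"
proof (rule linear_map_zero_on_span[OF word_module_module V _ tensor_relations_closed])
  let ?F = "word_module R M"
  interpret F: module R ?F by (rule word_module_module)
  interpret V: module R V by fact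
  have cl: "g w \<in> carrier V" if "w \<in> words M" for w using word_multilinear_closed[OF g that] .
  have lin: "linear_extension R V g \<in> linear_maps R ?F V"
    by (rule V.linear_extension_linear) (use cl in blast)
  then show "linear_extension R V g \<in> linear_maps R ?F V" .
  have self: "v \<ominus>\<^bsub>V\<^esub> v = \<zero>\<^bsub>V\<^esub>" if "v \<in> carrier V" for v
    using that by (simp add: a_minus_def V.M.r_neg)
  note minus = linear_maps_minus[OF word_module_module V lin]
  show "n \<in> span_module R ?F (tensor_relations R M)" using n by (simp only: tensor_kernel_def)
  fix r assume "r \<in> tensor_relations R M"
  then consider
    (add) x y a b where
      "r = single R (x @ (a \<oplus>\<^bsub>M\<^esub> b) # y)
        \<ominus>\<^bsub>?F\<^esub> (single R (x @ a # y) \<oplus>\<^bsub>?F\<^esub> single R (x @ b # y))"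
      "x \<in> lists (carrier M)" "y \<in> lists (carrier M)" "a \<in> carrier M" "b \<in> carrier M"
  | (smult) x y c a where
      "r = single R (x @ (c \<odot>\<^bsub>M\<^esub> a) # y) \<ominus>\<^bsub>?F\<^esub> c \<odot>\<^bsub>?F\<^esub> single R (x @ a # y)"
      "x \<in> lists (carrier M)" "y \<in> lists (carrier M)" "c \<in> carrier R" "a \<in> carrier M"
    unfolding tensor_relations_def Let_def append_Cons append_Nil by blast
  then show "linear_extension R V g r = \<zero>\<^bsub>V\<^esub>"
  proof cases
    case add
    note w = words_insertI[OF add(2) _ add(3)]
    have gw: "g (x @ (a \<oplus>\<^bsub>M\<^esub> b) # y) = g (x @ a # y) \<oplus>\<^bsub>V\<^esub> g (x @ b # y)"
      by (rule linear_mapsD(2)[OF word_multilinearD[OF g add(2,3)] add(4,5)])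
    show ?thesis
      using add(4,5) unfolding add(1)
      by (simp add: minus single_closed w linear_mapsD[OF lin] V.linear_extension_single cl gw self)
  next
    case smult
    note w = words_insertI[OF smult(2) _ smult(3)]
    have gw: "g (x @ (c \<odot>\<^bsub>M\<^esub> a) # y) = c \<odot>\<^bsub>V\<^esub> g (x @ a # y)"
      by (rule linear_mapsD(3)[OF word_multilinearD[OF g smult(2,3)] smult(4,5)])
    show ?thesis
      using smult(4,5) unfolding smult(1)
      by (simp add: minus single_closed w linear_mapsD[OF lin] V.linear_extension_single cl gw self)
  qed
qed

lemma tensor_lift_coset:
  assumes V: "module R V" and g: "word_multilinear R M V g" and f: "f \<in> carrier (word_module R M)"
  shows "tensor_lift R V g (tensor_kernel R M +>\<^bsub>word_module R M\<^esub> f) = linear_extension R V g f"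
proof -
  interpret F: module R "word_module R M" by (rule word_module_module)
  interpret V: module R V by fact
  have lin: "linear_extension R V g \<in> linear_maps R (word_module R M) V"
    by (rule V.linear_extension_linear) (use word_multilinear_closed[OF g] in blast)
  have "linear_extension R V g ` (tensor_kernel R M +>\<^bsub>word_module R M\<^esub> f) = {linear_extension R V g f}"
    by (rule F.image_coset[OF V tensor_kernel_submodule lin _ f]) (rule linear_extension_kernel[OF V g])
  then show ?thesis by (simp add: tensor_lift_def)
qed

lemma tensor_lift_word:
  assumes V: "module R V" and g: "word_multilinear R M V g" and w: "w \<in> words M"
  shows "tensor_lift R V g (tensor_word R M w) = g w"
  unfolding tensor_word_def tensor_lift_coset[OF V g single_closed[OF w]]
  by (rule module.linear_extension_single[OF V]) (rule word_multilinear_closed[OF g w])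

lemma tensor_lift_linear:
  assumes V: "module R V" and g: "word_multilinear R M V g"
  shows "tensor_lift R V g \<in> linear_maps R (tensor_module R M) V"
proof -
  let ?F = "word_module R M" and ?T = "tensor_module R M"
  let ?q = "\<lambda>f. tensor_kernel R M +>\<^bsub>?F\<^esub> f"
  interpret F: module R ?F by (rule word_module_module)
  interpret V: module R V by fact
  have lin: "linear_extension R V g \<in> linear_maps R ?F V"
    by (rule V.linear_extension_linear) (use word_multilinear_closed[OF g] in blast)
  note lift = tensor_lift_coset[OF V g] and ext = linear_mapsD[OF lin]
    and coset = linear_mapsD(2,3)[OF coset_tensor_linear, symmetric]
  show ?thesis
  proof (rule linear_mapsI)
    fix u assume "u \<in> carrier ?T"
    then obtain f where f: "f \<in> carrier ?F" "u = ?q f" by (rule tensor_carrierE)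
    show "tensor_lift R V g u \<in> carrier V" using f by (simp only: lift ext)
    show "tensor_lift R V g (c \<odot>\<^bsub>?T\<^esub> u) = c \<odot>\<^bsub>V\<^esub> tensor_lift R V g u" if "c \<in> carrier R" for c
      using f that by (simp only: coset lift ext F.smult_closed)
    fix v assume "v \<in> carrier ?T"
    then obtain h where h: "h \<in> carrier ?F" "v = ?q h" by (rule tensor_carrierE)
    show "tensor_lift R V g (u \<oplus>\<^bsub>?T\<^esub> v) = tensor_lift R V g u \<oplus>\<^bsub>V\<^esub> tensor_lift R V g v"
      using f h by (simp only: coset lift ext F.M.a_closed)
  qed
qed

end

subsection \<open>Concatenation and the dialgebra operations\<close>

text \<open>The tensor algebra differs from the tensor module only in the field \<open>mult\<close>,
  so everything built from the module structure alone agrees and the module lemmas carry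
  over.\<close>

lemma tensor_algebra_simps:
  "carrier (tensor_algebra R A) = carrier (tensor_module R A)"
  "add (tensor_algebra R A) = add (tensor_module R A)"
  "smult (tensor_algebra R A) = smult (tensor_module R A)"
  "a_minus (tensor_algebra R A) = a_minus (tensor_module R A)"
  "tensor_lift R (tensor_algebra R A) = tensor_lift R (tensor_module R A)"
  by (auto simp: tensor_algebra_def a_minus_def a_inv_def fun_eq_iff tensor_lift_def
      linear_extension_def finsum_def)

lemma tensor_dialgebra_simps:
  "carrier (tensor_dialgebra R A) = carrier (tensor_module R A)"
  "add (tensor_dialgebra R A) = add (tensor_module R A)"
  "smult (tensor_dialgebra R A) = smult (tensor_module R A)"
  "lop (tensor_dialgebra R A)
    = (\<lambda>u v. tensor_lift R (tensor_module R A) (lop_word R A (tensor_M R A u)) v)"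
  "rop (tensor_dialgebra R A)
    = (\<lambda>u v. u \<otimes>\<^bsub>tensor_algebra R A\<^esub> tensor_incl R A (tensor_M R A v))"
  by (simp_all add: tensor_dialgebra_def Let_def module.defs dialgebra.defs tensor_algebra_simps)

context module
begin

lemma append_word_multilinear:
  assumes "x \<in> lists (carrier M)"
  shows "word_multilinear R M (tensor_module R M) (\<lambda>y. tensor_word R M (x @ y))"
  unfolding word_multilinear_def
  using word_multilinearD[OF tensor_word_multilinear, of "x @ y" for y] assms by auto

text \<open>The product is a lift inside a lift, and the outer one is meaningful only if the inner
  one is multilinear in \<open>x\<close>. For a monomial \<open>v\<close> this is multilinearity of
  \<open>tensor_word\<close> in a longer word; sums and multiples in \<open>v\<close> are handled
  pointwise.\<close>

lemma tensor_left_factor_multilinear: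
  assumes v: "v \<in> carrier (tensor_module R M)"
  shows "word_multilinear R M (tensor_module R M)
    (\<lambda>x. tensor_lift R (tensor_module R M) (\<lambda>y. tensor_word R M (x @ y)) v)"
  unfolding word_multilinear_def
proof (intro ballI)
  let ?T = "tensor_module R M"
  interpret T: module R ?T by (rule tensor_module_module)
  fix x y assume x: "x \<in> lists (carrier M)" and y: "y \<in> lists (carrier M)"
  let ?L = "\<lambda>v a. tensor_lift R ?T (\<lambda>z. tensor_word R M ((x @ a # y) @ z)) v"
  have ml: "word_multilinear R M ?T (\<lambda>z. tensor_word R M ((x @ a # y) @ z))"
    if "a \<in> carrier M" for a
    using x y that by (intro append_word_multilinear) simp
  note lin = linear_mapsD[OF tensor_lift_linear[OF tensor_module_module ml]]
  show "?L v \<in> linear_maps R M ?T"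
    using v
  proof (induction v rule: tensor_module_induct)
    case (word w)
    have "(\<lambda>a. tensor_word R M (x @ a # (y @ w))) \<in> linear_maps R M ?T"
      using y words_lists[OF word] by (intro word_multilinearD[OF tensor_word_multilinear x]) simp
    then show ?case
      by (rule linear_maps_cong[OF module_axioms])
        (use tensor_lift_word[OF tensor_module_module ml word] in simp)
  next
    case (add u v)
    show ?case
      by (rule linear_maps_cong[OF module_axioms T.linear_maps_add[OF add(3,4)]])
        (rule lin(2)[OF _ add(1,2)])
  next
    case (smult c v)
    show ?case
      by (rule linear_maps_cong[OF module_axioms T.linear_maps_smult[OF smult(1,3)]])
        (rule lin(3)[OF _ smult(1,2)])
  qed
qed

lemma tensor_mult_def:
  "u \<otimes>\<^bsub>tensor_algebra R M\<^esub> v = tensor_lift R (tensor_module R M)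
     (\<lambda>x. tensor_lift R (tensor_module R M) (\<lambda>y. tensor_word R M (x @ y)) v) u"
  by (simp add: tensor_algebra_def)

lemma tensor_mult_linear_left:
  assumes "v \<in> carrier (tensor_module R M)"
  shows "(\<lambda>u. u \<otimes>\<^bsub>tensor_algebra R M\<^esub> v) \<in> linear_maps R (tensor_module R M) (tensor_module R M)"
  unfolding tensor_mult_def
  by (rule tensor_lift_linear[OF tensor_module_module tensor_left_factor_multilinear[OF assms]])

text \<open>The right factor is hidden inside the function being lifted. On a monomial
  \<open>u\<close> the outer lift evaluates and leaves a single lift in \<open>v\<close>; induction
  on \<open>u\<close> does the rest.\<close>

lemma tensor_mult_linear_right:
  assumes u: "u \<in> carrier (tensor_module R M)"
  shows "(\<lambda>v. u \<otimes>\<^bsub>tensor_algebra R M\<^esub> v) \<in> linear_maps R (tensor_module R M) (tensor_module R M)"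
proof -
  let ?T = "tensor_module R M"
  interpret T: module R ?T by (rule tensor_module_module)
  show ?thesis
    using u
  proof (induction u rule: tensor_module_induct)
    case (word w)
    have "tensor_lift R ?T (\<lambda>y. tensor_word R M (w @ y)) \<in> linear_maps R ?T ?T"
      by (intro tensor_lift_linear tensor_module_module append_word_multilinear words_lists[OF word])
    then show ?case
      by (rule linear_maps_cong[OF tensor_module_module])
        (simp only: tensor_mult_def
          tensor_lift_word[OF tensor_module_module tensor_left_factor_multilinear word])
  next
    case (add u v)
    show ?case
      by (rule linear_maps_cong[OF tensor_module_module T.linear_maps_add[OF add(3,4)]])
        (rule linear_mapsD(2)[OF tensor_mult_linear_left add(1,2)])
  next
    case (smult c u)
    show ?case
      by (rule linear_maps_cong[OF tensor_module_module T.linear_maps_smult[OF smult(1,3)]])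
        (rule linear_mapsD(3)[OF tensor_mult_linear_left smult(1,2)])
  qed
qed

lemma tensor_mult_word:
  assumes x: "x \<in> words M" and y: "y \<in> words M"
  shows "tensor_word R M x \<otimes>\<^bsub>tensor_algebra R M\<^esub> tensor_word R M y = tensor_word R M (x @ y)"
  unfolding tensor_mult_def
  by (simp only: tensor_lift_word[OF tensor_module_module] tensor_left_factor_multilinear
      append_word_multilinear tensor_word_closed words_lists x y)

lemma tensor_incl_linear: "tensor_incl R M \<in> linear_maps R M (tensor_module R M)"
  unfolding tensor_incl_def
  using word_multilinearD[OF tensor_word_multilinear, of "[]" "[]"] by simp

end

lemma lop_word_letter: "lop_word R A m [a] = tensor_incl R A (m \<otimes>\<^bsub>A\<^esub> a)"
  by (simp add: lop_word.simps)

lemma lop_word_snoc: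
  assumes "w \<noteq> []"
  shows "lop_word R A m (w @ [a]) =
    (lop_word R A m w \<otimes>\<^bsub>tensor_algebra R A\<^esub> tensor_incl R A a
      \<oplus>\<^bsub>tensor_module R A\<^esub> tensor_word R A w \<otimes>\<^bsub>tensor_algebra R A\<^esub> tensor_incl R A (m \<otimes>\<^bsub>A\<^esub> a))
    \<ominus>\<^bsub>tensor_module R A\<^esub>
      (tensor_word R A w \<otimes>\<^bsub>tensor_algebra R A\<^esub> tensor_incl R A m) \<otimes>\<^bsub>tensor_algebra R A\<^esub> tensor_incl R A a"
  using assms by (subst lop_word.simps) (simp add: Let_def tensor_algebra_simps)

section \<open>Left-normed products\<close>

abbreviation left_normed :: "('v \<Rightarrow> 'v \<Rightarrow> 'v) \<Rightarrow> 'v list \<Rightarrow> 'v" where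
  "left_normed f w \<equiv> foldl f (hd w) (tl w)"

lemma left_normed_snoc: "w \<noteq> [] \<Longrightarrow> left_normed f (w @ [a]) = f (left_normed f w) a"
  by simp

lemma left_normed_closed:
  assumes f: "bilinear_op R V f" and w: "w \<in> words V"
  shows "left_normed f w \<in> carrier V"
  using w
proof (induction w rule: words_induct)
  case (snoc w a)
  then show ?case
    using linear_mapsD(1)[OF bilinear_opD(1)[OF f]] by (simp add: words_def)
qed simp

text \<open>The last letter enters through the right argument of \<open>f\<close>, an earlier one
  through the left argument, and \<open>f\<close> is linear in both. The lemma serves twice: for
  \<open>M\<close>, with the product of \<open>A\<close> and the identity as \<open>h\<close>, and
  for \<open>lift\<close>, with \<stileturn> of \<open>B\<close> and \<open>\<tau>\<close>.\<close>

lemma (in module) left_normed_multilinear: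
  assumes f: "bilinear_op R V f" and h: "h \<in> linear_maps R M V"
  shows "word_multilinear R M V (\<lambda>w. left_normed f (map h w))"
proof (rule word_multilinear_snocI)
  have mapw: "map h w \<in> words V" if "w \<in> words M" for w
    using that linear_mapsD(1)[OF h] by (auto simp: words_def)
  show "(\<lambda>a. left_normed f (map h [a])) \<in> linear_maps R M V" using h by simp
  show "(\<lambda>a. left_normed f (map h (w @ [a]))) \<in> linear_maps R M V" if w: "w \<in> words M" for w
    using linear_maps_comp[OF h bilinear_opD(1)[OF f left_normed_closed[OF f mapw[OF w]]]] w
    by (simp add: words_def)
  show "(\<lambda>a. left_normed f (map h ((x @ a # y) @ [b]))) \<in> linear_maps R M V"
    if "b \<in> carrier M" and lin: "(\<lambda>a. left_normed f (map h (x @ a # y))) \<in> linear_maps R M V"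
    for x y b
  proof -
    have "left_normed f (map h ((x @ a # y) @ [b])) = f (left_normed f (map h (x @ a # y))) (h b)" for a
      using left_normed_snoc[of "map h (x @ a # y)" f "h b"] by simp
    then show ?thesis
      using linear_maps_comp[OF lin bilinear_opD(2)[OF f linear_mapsD(1)[OF h that(1)]]] by simp
  qed
qed

section \<open>The map \<open>M\<close> and the operations of the tensor dialgebra\<close>

context left_symmetric_algebra
begin

lemma mult_linear:
  assumes "m \<in> carrier A"
  shows "(\<lambda>a. m \<otimes>\<^bsub>A\<^esub> a) \<in> linear_maps R A A"
  using bilinear_opD(1)[OF bilinear assms] .

lemma tensor_M_multilinear: "word_multilinear R A A (left_normed (\<otimes>\<^bsub>A\<^esub>))"
  using left_normed_multilinear[OF bilinear, of "\<lambda>a. a"] by (simp add: linear_maps_def)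

lemma tensor_M_linear: "tensor_M R A \<in> linear_maps R (tensor_module R A) A"
  unfolding tensor_M_def by (rule tensor_lift_linear[OF module_axioms tensor_M_multilinear])

lemma tensor_M_word: "w \<in> words A \<Longrightarrow> tensor_M R A (tensor_word R A w) = left_normed (\<otimes>\<^bsub>A\<^esub>) w"
  unfolding tensor_M_def by (rule tensor_lift_word[OF module_axioms tensor_M_multilinear])

lemma lop_word_closed:
  assumes m: "m \<in> carrier A" and w: "w \<in> words A"
  shows "lop_word R A m w \<in> carrier (tensor_module R A)"
  using w
proof (induction w rule: words_induct)
  case (letter a)
  then show ?case
    by (simp add: lop_word_letter linear_mapsD(1)[OF tensor_incl_linear]
        linear_mapsD(1)[OF mult_linear[OF m]])
next
  case (snoc w a)
  interpret T: module R "tensor_module R A" by (rule tensor_module_module)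
  from snoc have ne: "w \<noteq> []" by (simp add: words_def)
  from snoc show ?case
    by (simp only: lop_word_snoc[OF ne] T.M.minus_closed T.M.a_closed tensor_word_closed
        linear_mapsD(1)[OF tensor_mult_linear_right] linear_mapsD(1)[OF tensor_incl_linear] m
        linear_mapsD(1)[OF mult_linear[OF m]])
qed

lemma lop_word_multilinear:
  assumes m: "m \<in> carrier A"
  shows "word_multilinear R A (tensor_module R A) (lop_word R A m)"
proof (rule word_multilinear_snocI)
  let ?T = "tensor_module R A" and ?S = "tensor_algebra R A" and ?i = "tensor_incl R A"
  interpret T: module R ?T by (rule tensor_module_module)
  note i = tensor_incl_linear and ml = mult_linear[OF m] and tr = tensor_mult_linear_right
    and tl = tensor_mult_linear_left
  note ic = linear_mapsD(1)[OF i]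
  show "(\<lambda>a. lop_word R A m [a]) \<in> linear_maps R A ?T"
    unfolding lop_word_letter by (rule linear_maps_comp[OF ml i])
  \<comment> \<open>The letter \<open>a\<close> occurs once in each of the three terms of the
    recursion, as a right factor or inside the product of \<open>m\<close> and
    \<open>a\<close>.\<close>
  show "(\<lambda>a. lop_word R A m (w @ [a])) \<in> linear_maps R A ?T" if w: "w \<in> words A" for w
  proof -
    from w have ne: "w \<noteq> []" by (simp add: words_def)
    show ?thesis
      unfolding lop_word_snoc[OF ne]
      by (intro T.linear_maps_diff T.linear_maps_add linear_maps_comp[OF i tr]
          linear_maps_comp[OF linear_maps_comp[OF ml i] tr] lop_word_closed[OF m w]
          tensor_word_closed[OF w] linear_mapsD(1)[OF tr] ic m)
  qed
  \<comment> \<open>Here \<open>a\<close> sits in the left factors: the first term uses the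
    hypothesis \<open>lin\<close>, the other two use multilinearity of
    \<open>tensor_word\<close>.\<close>
  show "(\<lambda>a. lop_word R A m ((x @ a # y) @ [b])) \<in> linear_maps R A ?T"
    if x: "x \<in> lists (carrier A)" and y: "y \<in> lists (carrier A)" and b: "b \<in> carrier A"
      and lin: "(\<lambda>a. lop_word R A m (x @ a # y)) \<in> linear_maps R A ?T" for x y b
  proof -
    note w = word_multilinearD[OF tensor_word_multilinear x y]
    have ne: "x @ a # y \<noteq> []" for a by simp
    show ?thesis
      unfolding lop_word_snoc[OF ne]
      by (intro T.linear_maps_diff T.linear_maps_add linear_maps_comp[OF lin tl]
          linear_maps_comp[OF w tl] linear_maps_comp[OF linear_maps_comp[OF w tl] tl]
          ic m b linear_mapsD(1)[OF ml])
  qed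
qed

lemma tensor_dialgebra_lop_word:
  assumes "u \<in> carrier (tensor_module R A)" "w \<in> words A"
  shows "u \<turnstile>\<^bsub>tensor_dialgebra R A\<^esub> tensor_word R A w = lop_word R A (tensor_M R A u) w"
  using tensor_lift_word[OF tensor_module_module
      lop_word_multilinear[OF linear_mapsD(1)[OF tensor_M_linear assms(1)]] assms(2)]
  by (simp add: tensor_dialgebra_simps)

lemma tensor_dialgebra_lop_linear:
  assumes "u \<in> carrier (tensor_module R A)"
  shows "(\<turnstile>\<^bsub>tensor_dialgebra R A\<^esub>) u \<in> linear_maps R (tensor_module R A) (tensor_module R A)"
  using tensor_lift_linear[OF tensor_module_module
      lop_word_multilinear[OF linear_mapsD(1)[OF tensor_M_linear assms]]]
  by (simp add: tensor_dialgebra_simps)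

lemma tensor_dialgebra_rop_closed:
  assumes "u \<in> carrier (tensor_module R A)" "v \<in> carrier (tensor_module R A)"
  shows "u \<stileturn>\<^bsub>tensor_dialgebra R A\<^esub> v \<in> carrier (tensor_module R A)"
  unfolding tensor_dialgebra_simps
  by (intro linear_mapsD(1)[OF tensor_mult_linear_right] linear_mapsD(1)[OF tensor_incl_linear]
      linear_mapsD(1)[OF tensor_M_linear] assms)

text \<open>\<open>M\<close> fixes letters, so appending a letter is an instance of \<stileturn>.
  Hence the letters generate the dialgebra, which is the source of uniqueness.\<close>

lemma tensor_dialgebra_rop_letter:
  assumes "w \<in> words A" "a \<in> carrier A"
  shows "tensor_word R A w \<stileturn>\<^bsub>tensor_dialgebra R A\<^esub> tensor_incl R A a = tensor_word R A (w @ [a])"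
proof -
  have a: "[a] \<in> words A" using assms(2) by (simp add: words_def)
  then show ?thesis
    by (simp add: tensor_dialgebra_simps tensor_incl_def tensor_M_word tensor_mult_word assms(1))
qed

end

subsection \<open>The universal property\<close>

lemma algebra_hom_left_algebraD:
  assumes "\<tau> \<in> algebra_hom R A (left_algebra B)"
  shows "\<tau> \<in> linear_maps R A B"
    and "\<lbrakk>a \<in> carrier A; b \<in> carrier A\<rbrakk> \<Longrightarrow> \<tau> (a \<otimes>\<^bsub>A\<^esub> b) = \<tau> a \<turnstile>\<^bsub>B\<^esub> \<tau> b"
  using assms by (auto simp: algebra_hom_def linear_maps_def left_algebra_def)

text \<open>The shape in which left-symmetry meets the recursion for \<turnstile>: two terms added,
  one subtracted.\<close>

lemma (in abelian_group) minus_eq_minusD: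
  assumes [simp]: "x \<in> carrier G" "y \<in> carrier G" "z \<in> carrier G" "t \<in> carrier G"
    and eq: "x \<ominus> y = z \<ominus> t"
  shows "(z \<oplus> y) \<ominus> x = t"
proof -
  have "z = (z \<ominus> t) \<oplus> t" by (simp add: a_minus_def a_assoc l_neg)
  also have "\<dots> = (x \<ominus> y) \<oplus> t" by (simp only: eq)
  finally have "(z \<oplus> y) \<ominus> x = ((x \<oplus> \<ominus> x) \<oplus> (y \<oplus> \<ominus> y)) \<oplus> t"
    by (simp add: a_minus_def a_ac)
  then show ?thesis by (simp add: r_neg)
qed

locale universal_problem =
  A: left_symmetric_algebra R A + B: left_symmetric_dialgebra R B
  for R :: "('k, 'r) ring_scheme" and A :: "('k, 'a, 'm) module_scheme"
    and B :: "('k, 'b, 'n) dialgebra_scheme" +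
  fixes \<tau> :: "'a \<Rightarrow> 'b"
  assumes hom: "\<tau> \<in> algebra_hom R A (left_algebra B)"
begin

abbreviation T where "T \<equiv> tensor_module R A"

abbreviation D where "D \<equiv> tensor_dialgebra R A"

abbreviation M where "M \<equiv> tensor_M R A"

text \<open>The candidate for the homomorphism before its restriction to the carrier.\<close>

definition lift :: "('a list \<Rightarrow> 'k) set \<Rightarrow> 'b" where
  "lift = tensor_lift R B (\<lambda>w. left_normed (\<stileturn>\<^bsub>B\<^esub>) (map \<tau> w))"

lemmas \<tau>_linear = algebra_hom_left_algebraD(1)[OF hom]
lemmas \<tau>_mult = algebra_hom_left_algebraD(2)[OF hom]
lemmas \<tau>_closed = linear_mapsD(1)[OF \<tau>_linear]
lemmas M_closed = linear_mapsD(1)[OF A.tensor_M_linear]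
lemmas lop_right = bilinear_opD(1)[OF B.bilinear_lop]
lemmas lop_left = bilinear_opD(2)[OF B.bilinear_lop]
lemmas rop_right = bilinear_opD(1)[OF B.bilinear_rop]
lemmas rop_left = bilinear_opD(2)[OF B.bilinear_rop]
lemmas lop_closed = linear_mapsD(1)[OF lop_right]
lemmas rop_closed = linear_mapsD(1)[OF rop_right]

lemma lift_multilinear: "word_multilinear R A B (\<lambda>w. left_normed (\<stileturn>\<^bsub>B\<^esub>) (map \<tau> w))"
  by (rule A.left_normed_multilinear[OF B.bilinear_rop \<tau>_linear])

lemma lift_linear: "lift \<in> linear_maps R T B"
  unfolding lift_def by (rule A.tensor_lift_linear[OF B.module_axioms lift_multilinear])

lemmas lift_closed = linear_mapsD(1)[OF lift_linear]

lemma lift_word: "w \<in> words A \<Longrightarrow> lift (tensor_word R A w) = left_normed (\<stileturn>\<^bsub>B\<^esub>) (map \<tau> w)"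
  unfolding lift_def by (rule A.tensor_lift_word[OF B.module_axioms lift_multilinear])

lemma lift_incl: "a \<in> carrier A \<Longrightarrow> lift (tensor_incl R A a) = \<tau> a"
  by (simp add: tensor_incl_def lift_word words_def)

lemma lift_word_snoc:
  assumes "w \<in> words A" "a \<in> carrier A"
  shows "lift (tensor_word R A (w @ [a])) = lift (tensor_word R A w) \<stileturn>\<^bsub>B\<^esub> \<tau> a"
  using assms by (auto simp: lift_word words_def)

text \<open>Extends \<open>lift_word_snoc\<close> by linearity from monomials to all
  \<open>u\<close>; the recursion for \<turnstile> multiplies \<open>lop_word\<close>, which is in
  general no monomial, by a letter.\<close>

lemma lift_mult_incl:
  assumes u: "u \<in> carrier T" and a: "a \<in> carrier A"
  shows "lift (u \<otimes>\<^bsub>tensor_algebra R A\<^esub> tensor_incl R A a) = lift u \<stileturn>\<^bsub>B\<^esub> \<tau> a"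
proof (rule A.tensor_linear_ext[OF _ _ _ u])
  have aw: "[a] \<in> words A" using a by (simp add: words_def)
  show "(\<lambda>u. lift (u \<otimes>\<^bsub>tensor_algebra R A\<^esub> tensor_incl R A a)) \<in> linear_maps R T B"
    using linear_maps_comp[OF A.tensor_mult_linear_left lift_linear] A.tensor_word_closed[OF aw]
    by (simp add: tensor_incl_def)
  show "(\<lambda>u. lift u \<stileturn>\<^bsub>B\<^esub> \<tau> a) \<in> linear_maps R T B"
    by (rule linear_maps_comp[OF lift_linear rop_left[OF \<tau>_closed[OF a]]])
  show "lift (tensor_word R A w \<otimes>\<^bsub>tensor_algebra R A\<^esub> tensor_incl R A a)
      = lift (tensor_word R A w) \<stileturn>\<^bsub>B\<^esub> \<tau> a" if w: "w \<in> words A" for w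
    by (simp only: tensor_incl_def A.tensor_mult_word[OF w aw] lift_word_snoc[OF w a])
qed

text \<open>Since \<open>p \<turnstile> b = q \<turnstile> b\<close> for the images \<open>p\<close> and \<open>q\<close> of a word under \<open>lift\<close> and \<open>\<tau> \<circ> M\<close>, the two
  images of the word extended by a letter are \<open>p \<stileturn> b\<close> and \<open>p \<turnstile> b\<close>, which the bar identities
  identify.\<close>

lemma lift_word_similar:
  assumes "w \<in> words A" and x: "x \<in> carrier B"
  shows "x \<stileturn>\<^bsub>B\<^esub> lift (tensor_word R A w) = x \<stileturn>\<^bsub>B\<^esub> \<tau> (M (tensor_word R A w))
    \<and> lift (tensor_word R A w) \<turnstile>\<^bsub>B\<^esub> x = \<tau> (M (tensor_word R A w)) \<turnstile>\<^bsub>B\<^esub> x"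
  using assms
proof (induction w arbitrary: x rule: words_induct)
  case (letter a)
  then have "[a] \<in> words A" by (simp add: words_def)
  then show ?case by (simp add: lift_word A.tensor_M_word)
next
  case (snoc w a)
  let ?p = "lift (tensor_word R A w)" and ?m = "M (tensor_word R A w)"
  note w = snoc(1) and a = snoc(2) and x = snoc(4)
  have wa: "w @ [a] \<in> words A" and ne: "w \<noteq> []" using w a by (auto simp: words_def)
  have m: "?m \<in> carrier A" and p: "?p \<in> carrier B" and \<tau>a: "\<tau> a \<in> carrier B"
    using w a by (auto intro: M_closed lift_closed A.tensor_word_closed \<tau>_closed)
  have "M (tensor_word R A (w @ [a])) = ?m \<otimes>\<^bsub>A\<^esub> a"
    using w ne by (simp add: A.tensor_M_word[OF wa] A.tensor_M_word)
  then have eq: "\<tau> (M (tensor_word R A (w @ [a]))) = ?p \<turnstile>\<^bsub>B\<^esub> \<tau> a"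
    using snoc.IH[OF \<tau>a] \<tau>_mult[OF m a] by simp
  show ?case
    unfolding eq lift_word_snoc[OF w a]
    using B.right_bar[OF x p \<tau>a] B.left_bar[OF p \<tau>a x] by simp
qed

text \<open>Both sides are linear in \<open>u\<close>, so the monomial case
  \<open>lift_word_similar\<close> suffices; \<open>lop_lift\<close> is obtained in the same
  way.\<close>

lemma rop_lift:
  assumes "x \<in> carrier B" "u \<in> carrier T"
  shows "x \<stileturn>\<^bsub>B\<^esub> lift u = x \<stileturn>\<^bsub>B\<^esub> \<tau> (M u)"
  using lift_word_similar assms(1)
  by (intro A.tensor_linear_ext[OF linear_maps_comp[OF lift_linear rop_right]
      linear_maps_comp[OF linear_maps_comp[OF A.tensor_M_linear \<tau>_linear] rop_right] _ assms(2)])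
    auto

lemma lop_lift:
  assumes "x \<in> carrier B" "u \<in> carrier T"
  shows "lift u \<turnstile>\<^bsub>B\<^esub> x = \<tau> (M u) \<turnstile>\<^bsub>B\<^esub> x"
  using lift_word_similar assms(1)
  by (intro A.tensor_linear_ext[OF linear_maps_comp[OF lift_linear lop_left]
      linear_maps_comp[OF linear_maps_comp[OF A.tensor_M_linear \<tau>_linear] lop_left] _ assms(2)])
    auto

lemma lift_lop_word:
  assumes m: "m \<in> carrier A" and "w \<in> words A"
  shows "lift (lop_word R A m w) = \<tau> m \<turnstile>\<^bsub>B\<^esub> lift (tensor_word R A w)"
  using assms(2)
proof (induction w rule: words_induct)
  case (letter a)
  then show ?case
    by (simp only: lop_word_letter lift_incl linear_mapsD(1)[OF A.mult_linear[OF m]] \<tau>_mult m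
        tensor_incl_def[symmetric])
next
  case (snoc w a)
  interpret T: module R T by (rule A.tensor_module_module)
  let ?S = "tensor_algebra R A" and ?i = "tensor_incl R A" and ?w = "tensor_word R A w"
  let ?p = "lift ?w"
  note w = snoc(1) and a = snoc(2)
  note ic = linear_mapsD(1)[OF A.tensor_incl_linear] and mc = linear_mapsD(1)[OF A.tensor_mult_linear_right]
  have ne: "w \<noteq> []" using w by (simp add: words_def)
  have ma: "m \<otimes>\<^bsub>A\<^esub> a \<in> carrier A" using linear_mapsD(1)[OF A.mult_linear[OF m] a] .
  note cl = A.tensor_word_closed[OF w] A.lop_word_closed[OF m w] ic[OF a] ic[OF m] ic[OF ma]
  have B: "?p \<in> carrier B" "\<tau> m \<in> carrier B" "\<tau> a \<in> carrier B"
    by (simp_all add: lift_closed cl \<tau>_closed m a)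
  \<comment> \<open>\<open>lift\<close> is applied to the recursion term by term: each product with
    a letter becomes \<stileturn>, and the induction hypothesis rewrites the first term.\<close>
  have "lift (lop_word R A m (w @ [a]))
      = ((\<tau> m \<turnstile>\<^bsub>B\<^esub> ?p) \<stileturn>\<^bsub>B\<^esub> \<tau> a \<oplus>\<^bsub>B\<^esub> ?p \<stileturn>\<^bsub>B\<^esub> (\<tau> m \<turnstile>\<^bsub>B\<^esub> \<tau> a)) \<ominus>\<^bsub>B\<^esub> (?p \<stileturn>\<^bsub>B\<^esub> \<tau> m) \<stileturn>\<^bsub>B\<^esub> \<tau> a"
    by (simp only: lop_word_snoc[OF ne] linear_maps_minus[OF A.tensor_module_module B.module_axioms lift_linear]
        linear_mapsD(2)[OF lift_linear] lift_mult_incl cl mc T.M.a_closed snoc.IH \<tau>_mult m a ma)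
  also have "\<dots> = \<tau> m \<turnstile>\<^bsub>B\<^esub> (?p \<stileturn>\<^bsub>B\<^esub> \<tau> a)"
  proof -
    let ?x = "(?p \<stileturn>\<^bsub>B\<^esub> \<tau> m) \<stileturn>\<^bsub>B\<^esub> \<tau> a" and ?y = "?p \<stileturn>\<^bsub>B\<^esub> (\<tau> m \<stileturn>\<^bsub>B\<^esub> \<tau> a)"
    let ?z = "(\<tau> m \<turnstile>\<^bsub>B\<^esub> ?p) \<stileturn>\<^bsub>B\<^esub> \<tau> a" and ?t = "\<tau> m \<turnstile>\<^bsub>B\<^esub> (?p \<stileturn>\<^bsub>B\<^esub> \<tau> a)"
    have [simp]: "?x \<in> carrier B" "?y \<in> carrier B" "?z \<in> carrier B" "?t \<in> carrier B"
      using B by (simp_all add: lop_closed rop_closed)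
    \<comment> \<open>Left-symmetry for \<open>?p\<close>, \<open>\<tau> m\<close>,
      \<open>\<tau> a\<close>. It has \<stileturn> inside \<open>?y\<close> where the recursion has
      \<turnstile>; under the outer \<open>?p\<close> \<stileturn> the right bar identity makes the
      two equal.\<close>
    have "?x \<ominus>\<^bsub>B\<^esub> ?y = ?z \<ominus>\<^bsub>B\<^esub> ?t" by (rule B.left_symmetric_rop[OF B])
    then have "(?z \<oplus>\<^bsub>B\<^esub> ?y) \<ominus>\<^bsub>B\<^esub> ?x = ?t" by (rule B.minus_eq_minusD[rotated 4]) simp_all
    then show ?thesis by (simp only: B.right_bar[OF B])
  qed
  finally show ?case by (simp only: lift_word_snoc[OF w a])
qed

text \<open>Both sides are linear in \<open>v\<close>. On a monomial, \<open>lift_lop_word\<close>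
  with \<open>M u\<close> for \<open>m\<close> gives \<open>\<tau> (M u)\<close> as left factor, and
  \<open>lop_lift\<close> replaces it by \<open>lift u\<close>.\<close>

lemma lift_lop:
  assumes u: "u \<in> carrier T" and v: "v \<in> carrier T"
  shows "lift (u \<turnstile>\<^bsub>D\<^esub> v) = lift u \<turnstile>\<^bsub>B\<^esub> lift v"
  by (rule A.tensor_linear_ext[OF linear_maps_comp[OF A.tensor_dialgebra_lop_linear[OF u] lift_linear]
        linear_maps_comp[OF lift_linear lop_right[OF lift_closed[OF u]]] _ v])
    (simp add: A.tensor_dialgebra_lop_word u lift_lop_word M_closed lop_lift lift_closed
      A.tensor_word_closed)

lemma lift_rop:
  assumes u: "u \<in> carrier T" and v: "v \<in> carrier T"
  shows "lift (u \<stileturn>\<^bsub>D\<^esub> v) = lift u \<stileturn>\<^bsub>B\<^esub> lift v"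
  by (simp add: tensor_dialgebra_simps lift_mult_incl rop_lift M_closed lift_closed u v)

text \<open>Functions are total, so uniqueness can only hold among maps with a fixed value off the
  carrier. Closure of the carrier under both operations ensures that the restriction agrees with
  \<open>lift\<close> on every product.\<close>

lemma restrict_lift_hom: "restrict lift (carrier T) \<in> dialgebra_hom R D B"
proof -
  interpret T: module R T by (rule A.tensor_module_module)
  have "u \<turnstile>\<^bsub>D\<^esub> v \<in> carrier T" if "u \<in> carrier T" "v \<in> carrier T" for u v
    using linear_mapsD(1)[OF A.tensor_dialgebra_lop_linear] that .
  then show ?thesis
    by (auto simp: dialgebra_hom_def linear_maps_def tensor_dialgebra_simps(1-3) lift_lop lift_rop
        A.tensor_dialgebra_rop_closed linear_mapsD[OF lift_linear])
qed

text \<open>By linearity it suffices to compare on monomials; there both maps satisfy the same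
  recursion, since the last letter is attached by \<stileturn>.\<close>

lemma hom_eq_lift:
  assumes \<psi>: "\<psi> \<in> dialgebra_hom R D B"
    and incl: "\<And>a. a \<in> carrier A \<Longrightarrow> \<psi> (tensor_incl R A a) = \<tau> a"
    and u: "u \<in> carrier T"
  shows "\<psi> u = lift u"
proof (rule A.tensor_linear_ext[OF _ lift_linear _ u])
  show "\<psi> \<in> linear_maps R T B"
    using \<psi> by (simp add: dialgebra_hom_def linear_maps_def tensor_dialgebra_simps)
  show "\<psi> (tensor_word R A w) = lift (tensor_word R A w)" if "w \<in> words A" for w
    using that
  proof (induction w rule: words_induct)
    case (letter a)
    then show ?case by (simp only: tensor_incl_def[symmetric] incl lift_incl)
  next
    case (snoc w a)
    have "\<psi> (tensor_word R A w \<stileturn>\<^bsub>D\<^esub> tensor_incl R A a) = \<psi> (tensor_word R A w) \<stileturn>\<^bsub>B\<^esub> \<psi> (tensor_incl R A a)"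
      using \<psi> A.tensor_word_closed[OF snoc(1)] linear_mapsD(1)[OF A.tensor_incl_linear snoc(2)]
      by (simp add: dialgebra_hom_def tensor_dialgebra_simps(1))
    then show ?case
      by (simp only: A.tensor_dialgebra_rop_letter snoc incl lift_word_snoc)
  qed
qed

end

theorem proposition2:
  fixes R :: "('k, 'r) ring_scheme"
    and A :: "('k, 'a, 'm) module_scheme"
    and B :: "('k, 'b, 'n) dialgebra_scheme"
    and \<tau> :: "'a \<Rightarrow> 'b"
  assumes "left_symmetric_algebra R A"
    and "left_symmetric_dialgebra R B"
    and "\<tau> \<in> algebra_hom R A (left_algebra B)"
  shows "\<exists>!\<phi>. \<phi> \<in> extensional (carrier (tensor_dialgebra R A)) \<and>
           \<phi> \<in> dialgebra_hom R (tensor_dialgebra R A) B \<and>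
           (\<forall>a \<in> carrier A. \<phi> (tensor_incl R A a) = \<tau> a)"
proof -
  interpret universal_problem R A B \<tau>
    using assms by (intro universal_problem.intro universal_problem_axioms.intro)
  show ?thesis
  proof (rule ex1I)
    show "restrict lift (carrier T) \<in> extensional (carrier D) \<and>
        restrict lift (carrier T) \<in> dialgebra_hom R D B \<and>
        (\<forall>a\<in>carrier A. restrict lift (carrier T) (tensor_incl R A a) = \<tau> a)"
      using restrict_lift_hom lift_incl linear_mapsD(1)[OF A.tensor_incl_linear]
      by (simp add: tensor_dialgebra_simps(1))
  next
    fix \<psi>
    assume "\<psi> \<in> extensional (carrier D) \<and> \<psi> \<in> dialgebra_hom R D B \<and>
        (\<forall>a\<in>carrier A. \<psi> (tensor_incl R A a) = \<tau> a)"
    then show "\<psi> = restrict lift (carrier T)"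
      using hom_eq_lift
      by (intro extensionalityI[of _ "carrier T"]) (auto simp: tensor_dialgebra_simps(1))
  qed
qed

end
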